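(* Let $\lambda<1$. Then $$\{\gamma\in\mathbb{C}:\ I_\gamma[f]\in\mathcal{S}\text{ for all } f\in\mathcal{K}(\lambda)\}=\left\{\gamma\in\mathbb{C}:\,|\gamma|\le \frac{1}{2(1-\lambda)}\right\}\bigcup \left[\frac{1}{2(1-\lambda)},\frac{3}{2(1-\lambda)}\right].$$
   Context: $\mathbb{D}=\{z\in\mathbb{C}:|z|<1\}$. $\mathcal{A}$ is the class of analytic functions $f$ on $\mathbb{D}$ with $f(0)=0$, $f'(0)=1$; $\mathcal{S}\subset\mathcal{A}$ is the subclass of univalent functions. For $\lambda<1$, $\mathcal{K}(\lambda)=\{f\in\mathcal{A}: f'\neq0 \text{ on }\mathbb{D},\ \mathrm{Re}\,(1+zf''(z)/f'(z))>\lambda \text{ for } z\in\mathbb{D}\}$. For $\gamma\in\mathbb{C}$ and $f\in\mathcal{A}$ with $f'$ nonvanishing on $\mathbb{D}$, the Hornich scalar multiplication is $I_\gamma[f](z)=\int_0^z \{f'(w)\}^\gamma\,dw$, where $\{f'(w)\}^\gamma=\exp(\gamma\log f'(w))$ with the branch chosen so that $\{f'(0)\}^\gamma=1$. For real $a<b$, $[a,b]$ denotes the real segment. *)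

theory Defs
  imports "HOL-Complex_Analysis.Complex_Analysis"
begin

abbreviation unit_disk :: "complex set" where
  "unit_disk \<equiv> ball 0 1"

definition classA :: "(complex \<Rightarrow> complex) \<Rightarrow> bool" where
  "classA f \<longleftrightarrow> f holomorphic_on unit_disk \<and> f 0 = 0 \<and> deriv f 0 = 1"

definition classS :: "(complex \<Rightarrow> complex) \<Rightarrow> bool" where
  "classS f \<longleftrightarrow> classA f \<and> inj_on f unit_disk"

definition classK :: "real \<Rightarrow> (complex \<Rightarrow> complex) \<Rightarrow> bool" where
  "classK lam f \<longleftrightarrow> classA f \<and> (\<forall>z\<in>unit_disk. deriv f z \<noteq> 0) \<and>
     (\<forall>z\<in>unit_disk. Re (1 + z * deriv (deriv f) z / deriv f z) > lam)"

text \<open>The branch of log f' on the disk with value 0 at 0 (unique when f' is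
  nonvanishing on the disk and f'(0)=1).\<close>
definition log_deriv_branch :: "(complex \<Rightarrow> complex) \<Rightarrow> complex \<Rightarrow> complex" where
  "log_deriv_branch f = (SOME L. L holomorphic_on unit_disk \<and> L 0 = 0 \<and>
      (\<forall>z\<in>unit_disk. exp (L z) = deriv f z))"

definition hornich :: "complex \<Rightarrow> (complex \<Rightarrow> complex) \<Rightarrow> complex \<Rightarrow> complex" where
  "hornich \<gamma> f z = contour_integral (linepath 0 z) (\<lambda>w. exp (\<gamma> * log_deriv_branch f w))"

end

theory Submission
  imports Defs
begin

text \<open>
  If f is in K(lam), then f' = exp((1 - lam) L) where exp L is the derivative of a convex function, so with
  c = 2 (1 - lam) \<gamma> the derivative of the transform is F' = exp(c L / 2). Writing
  p(z) = 1 + z L'(z), we have Re p > 0.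

  Univalence is proved with chains F + A(r) H on the discs |w| \<le> r, where A decreases to 0 as r
  grows to 1. The condition on the boundary says that the preimages of a fixed value enter the disc
  faster than its radius shrinks; hence two colliding points would survive for smaller r, whereas
  for small r the term A(r) H dominates and is injective.

  \<^item> |c| \<le> 1, c \<noteq> 1: take H(w) = w F'(w) and A(r) = (r^(-2) - 1) / (1 - c), which is the chain behind the
    Ahlfors criterion |(1 - |w|^2) w F''/F' - c |w|^2| < 1; this holds because Re p > 0 places p in an
    explicit disc.
  \<^item> c in [1, 3]: F'/exp L = exp((c/2 - 1) L) has positive real part because |Im L| < pi, so F is
    close-to-convex; take H(w) = w exp(L w) and A(r) = r^(-N) - 1 with N large.

  For all other c there is \<mu> in (0, 1] such that d = \<mu> c satisfies |d| > 1 and |d - 2| > 1. The function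
  with f' = (1 - z)^(-2 (1 - lam) \<mu>) is in K(lam), and its transform is an affine image of (1 - z)^(1 - d),
  which is not injective on the disc.
\<close>

section \<open>Univalence by chains\<close>

text \<open>The remainder \<open>f x - d * x\<close> is Lipschitz with constant
  \<open>norm d / 2\<close> on the convex set, too small to cancel the linear part
  \<open>d * (x - y)\<close>.\<close>

lemma inj_on_if_deriv_near_constant:
  fixes f :: "complex \<Rightarrow> complex"
  assumes "convex S"
    and der: "\<And>x. x \<in> S \<Longrightarrow> (f has_field_derivative f' x) (at x within S)"
    and bnd: "\<And>x. x \<in> S \<Longrightarrow> norm (f' x - d) \<le> norm d / 2"
    and "d \<noteq> 0"
  shows "inj_on f S"
proof (rule inj_onI)
  fix x y assume xy: "x \<in> S" "y \<in> S" "f x = f y"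
  have "norm ((f x - d * x) - (f y - d * y)) \<le> norm d / 2 * norm (x - y)"
  proof (rule field_differentiable_bound[OF \<open>convex S\<close> _ bnd])
    show "((\<lambda>x. f x - d * x) has_field_derivative f' z - d) (at z within S)" if "z \<in> S" for z
      using der[OF that] by (auto intro!: derivative_eq_intros)
  qed (use xy in auto)
  moreover have "(f x - d * x) - (f y - d * y) = - d * (x - y)"
    using xy by (simp add: algebra_simps)
  ultimately have "norm d * norm (x - y) \<le> norm d / 2 * norm (x - y)"
    by (simp add: norm_mult)
  then show "x = y" using \<open>d \<noteq> 0\<close> by auto
qed

text \<open>The implicit function theorem in existence form. Differentiating
  \<open>F w + A (r0 - \<epsilon>) * H w = const\<close> in \<open>\<epsilon>\<close> at 0 gives
  \<open>D * v = A' * H w0\<close>, which explains the velocity \<open>v\<close>. The solution found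
  lies within \<open>\<kappa> * \<epsilon>\<close> of the linear prediction, for a
  \<open>\<kappa>\<close> fixed in advance.\<close>

lemma perturbed_preimage:
  fixes F H :: "complex \<Rightarrow> complex" and A :: "real \<Rightarrow> complex"
  assumes "open U" "w0 \<in> U" and hol: "F holomorphic_on U" "H holomorphic_on U"
    and A: "(A has_vector_derivative A') (at r0)"
    and D: "D = deriv F w0 + A r0 * deriv H w0" "D \<noteq> 0"
    and v: "v = A' * H w0 / D" and "\<kappa> > 0"
  shows "\<forall>\<^sub>F \<epsilon> in at_right 0. \<exists>w \<in> cball (w0 + of_real \<epsilon> * v) (\<kappa> * \<epsilon>).
           F w + A (r0 - \<epsilon>) * H w = F w0 + A r0 * H w0"
proof -
  \<comment> \<open>The root of the linearised equation is w0 + \<epsilon> v; Brouwer's theorem for the simplified Newton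
    map T gives an exact root nearby.\<close>
  define \<Phi> where "\<Phi> = (\<lambda>p. F (snd p) + A (fst p) * H (snd p))"
  define L where "L = (\<lambda>p. D * snd p + of_real (fst p) * A' * H w0)"
  have F: "(F has_derivative (*) (deriv F w0)) (at (snd (r0, w0)))"
    and H: "(H has_derivative (*) (deriv H w0)) (at (snd (r0, w0)))"
    using holomorphic_derivI[OF hol(1) \<open>open U\<close> \<open>w0 \<in> U\<close>] holomorphic_derivI[OF hol(2) \<open>open U\<close> \<open>w0 \<in> U\<close>]
    by (simp_all add: has_field_derivative_def)
  have F': "((\<lambda>p::real\<times>complex. F (snd p)) has_derivative (\<lambda>p. deriv F w0 * snd p)) (at (r0, w0))"
    using has_derivative_compose[OF has_derivative_snd[OF has_derivative_ident] F] by simp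
  have H': "((\<lambda>p::real\<times>complex. H (snd p)) has_derivative (\<lambda>p. deriv H w0 * snd p)) (at (r0, w0))"
    using has_derivative_compose[OF has_derivative_snd[OF has_derivative_ident] H] by simp
  have "(A has_derivative (\<lambda>x. x *\<^sub>R A')) (at (fst (r0, w0)))"
    using A by (simp add: has_vector_derivative_def)
  from has_derivative_compose[OF has_derivative_fst[OF has_derivative_ident] this]
  have A': "((\<lambda>p::real\<times>complex. A (fst p)) has_derivative (\<lambda>p. fst p *\<^sub>R A')) (at (r0, w0))"
    by simp
  have "(\<Phi> has_derivative L) (at (r0, w0))"
    unfolding \<Phi>_def
    by (rule has_derivative_eq_rhs[OF has_derivative_add[OF F' has_derivative_mult[OF A' H']]])
       (auto simp: L_def D(1) fun_eq_iff scaleR_conv_of_real algebra_simps)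
  \<comment> \<open>Points of the ball lie within \<open>\<epsilon> * M\<close> of
    \<open>w0\<close>, so the increment of the pair has norm at most
    \<open>\<epsilon> * (1 + M)\<close>. The tolerance \<open>e\<close> is tuned so that the
    linearisation error divided by \<open>D\<close> is at most \<open>\<kappa> * \<epsilon>\<close>,
    the radius of the ball that \<open>T\<close> has to preserve.\<close>
  moreover define M where "M = norm v + \<kappa>"
  have "M > 0" using \<open>\<kappa> > 0\<close> by (auto simp: M_def intro: add_nonneg_pos)
  moreover define e where "e = \<kappa> * norm D / (1 + M)"
  have "e > 0" using \<open>\<kappa> > 0\<close> \<open>M > 0\<close> D(2) by (simp add: e_def)
  ultimately obtain d where "d > 0"
    and d: "\<And>p. norm (p - (r0, w0)) < d \<Longrightarrow>
               norm (\<Phi> p - \<Phi> (r0, w0) - L (p - (r0, w0))) \<le> e * norm (p - (r0, w0))"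
    unfolding has_derivative_at_alt by blast
  obtain d' where "d' > 0" and d': "cball w0 d' \<subseteq> U"
    using \<open>open U\<close> \<open>w0 \<in> U\<close> open_contains_cball by blast
  have "\<exists>w \<in> cball (w0 + of_real \<epsilon> * v) (\<kappa> * \<epsilon>).
           F w + A (r0 - \<epsilon>) * H w = F w0 + A r0 * H w0"
    if \<epsilon>: "0 < \<epsilon>" "\<epsilon> < min (d / (1 + M)) (d' / M)" for \<epsilon>
  proof -
    let ?B = "cball (w0 + of_real \<epsilon> * v) (\<kappa> * \<epsilon>)"
    have w: "norm (w - w0) \<le> \<epsilon> * M" if "w \<in> ?B" for w
    proof -
      have "norm (w - w0) \<le> norm (w - (w0 + of_real \<epsilon> * v)) + norm (of_real \<epsilon> * v)"
        using norm_triangle_ineq[of "w - (w0 + of_real \<epsilon> * v)" "of_real \<epsilon> * v"] by simp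
      also have "\<dots> \<le> \<kappa> * \<epsilon> + \<epsilon> * norm v"
        using that \<epsilon> by (simp add: dist_norm norm_minus_commute norm_mult)
      finally show ?thesis by (simp add: M_def algebra_simps)
    qed
    have \<epsilon>M: "\<epsilon> * M < d'" "\<epsilon> * (1 + M) < d"
      using \<epsilon> \<open>M > 0\<close> by (simp_all add: field_simps)
    have B: "?B \<subseteq> U"
    proof
      fix w assume "w \<in> ?B"
      from w[OF this] \<epsilon>M have "w \<in> cball w0 d'" by (simp add: dist_norm norm_minus_commute)
      then show "w \<in> U" using d' by blast
    qed
    define T where "T = (\<lambda>w. w - (\<Phi> (r0 - \<epsilon>, w) - \<Phi> (r0, w0)) / D)"
    have "T w \<in> ?B" if "w \<in> ?B" for w
    proof -
      have "norm ((r0 - \<epsilon>, w) - (r0, w0)) \<le> norm (- \<epsilon>) + norm (w - w0)"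
        using norm_Pair_le[of "- \<epsilon>" "w - w0"] by simp
      also have "\<dots> \<le> \<epsilon> * (1 + M)" using w[OF that] \<epsilon> by (simp add: algebra_simps)
      finally have n: "norm ((r0 - \<epsilon>, w) - (r0, w0)) \<le> \<epsilon> * (1 + M)" .
      let ?E = "\<Phi> (r0 - \<epsilon>, w) - \<Phi> (r0, w0) - L ((r0 - \<epsilon>, w) - (r0, w0))"
      have "norm ?E \<le> e * norm ((r0 - \<epsilon>, w) - (r0, w0))"
        using n \<epsilon>M by (intro d) linarith
      also have "\<dots> \<le> e * (\<epsilon> * (1 + M))" using n \<open>e > 0\<close> by (intro mult_left_mono) auto
      also have "\<dots> = \<kappa> * \<epsilon> * norm D" using \<open>M > 0\<close> by (simp add: e_def)
      finally have E: "norm ?E \<le> \<kappa> * \<epsilon> * norm D" .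
      have "(w0 + of_real \<epsilon> * v) - T w = ?E / D"
        using D(2) by (simp add: T_def L_def v field_simps)
      then have "norm ((w0 + of_real \<epsilon> * v) - T w) = norm ?E / norm D"
        by (simp only: norm_divide)
      also have "\<dots> \<le> \<kappa> * \<epsilon>"
        using E D(2) by (simp only: divide_le_eq) simp
      finally show ?thesis by (simp only: mem_cball dist_norm)
    qed
    moreover have "continuous_on ?B T"
      unfolding T_def \<Phi>_def fst_conv snd_conv using D(2)
      by (intro continuous_intros holomorphic_on_imp_continuous_on hol[THEN holomorphic_on_subset, OF B]) auto
    ultimately obtain w where "w \<in> ?B" "T w = w"
      using brouwer_ball[of "\<kappa> * \<epsilon>" "w0 + of_real \<epsilon> * v" T] \<epsilon> \<open>\<kappa> > 0\<close> by auto
    then show ?thesis using D(2) by (auto simp: T_def \<Phi>_def)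
  qed
  moreover have "min (d / (1 + M)) (d' / M) > 0" using \<open>d > 0\<close> \<open>d' > 0\<close> \<open>M > 0\<close> by simp
  ultimately show ?thesis
    unfolding eventually_at_right_field by blast
qed

text \<open>With \<open>v = A' * H w0 / D\<close>, \<open>inward\<close> reads
  \<open>- r0 * Re (v / w0) > 1\<close>: on the boundary circle the modulus of the preimage drops
  faster than the radius, which drops at rate 1. For \<open>norm w0 < r0\<close> continuity is
  enough. The ball of radius \<open>\<delta>\<close> will keep the preimages of two distinct points
  apart.\<close>

lemma preimage_moves_inward:
  fixes F H :: "complex \<Rightarrow> complex" and A :: "real \<Rightarrow> complex"
  assumes hol: "F holomorphic_on ball 0 1" "H holomorphic_on ball 0 1"
    and A: "(A has_vector_derivative A') (at r0)"
    and r0: "0 < r0" "r0 < 1" "norm w0 \<le> r0" and "\<delta> > 0"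
    and D: "D = deriv F w0 + A r0 * deriv H w0" "D \<noteq> 0"
    and inward: "norm w0 = r0 \<Longrightarrow> Re (- of_real r0 * A' * H w0 / (w0 * D)) > 1"
  shows "\<forall>\<^sub>F \<epsilon> in at_right 0. \<exists>w \<in> ball w0 \<delta>. norm w \<le> r0 - \<epsilon> \<and>
           F w + A (r0 - \<epsilon>) * H w = F w0 + A r0 * H w0"
proof -
  define v where "v = A' * H w0 / D"
  have "\<exists>\<kappa>>0. \<forall>\<^sub>F \<epsilon> in at_right 0. norm (w0 + of_real \<epsilon> * v) \<le> r0 - \<epsilon> * (1 + \<kappa>)"
  proof (cases "norm w0 = r0")
    case True
    \<comment> \<open>The inward speed is \<open>1 + 2 * \<kappa>\<close>. One
      \<open>\<kappa>\<close> absorbs the term of second order in \<open>\<epsilon>\<close>, the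
      other pays for the error radius \<open>\<kappa> * \<epsilon>\<close> of
      \<open>perturbed_preimage\<close>.\<close>
    define \<kappa> where "\<kappa> = (Re (- of_real r0 * v / w0) - 1) / 2"
    have "Re (- of_real r0 * v / w0) > 1"
      using inward[OF True] by (simp add: v_def mult_ac)
    then have "\<kappa> > 0" by (simp add: \<kappa>_def)
    have "w0 \<noteq> 0" using True r0 by auto
    have "v / w0 = v * cnj w0 / of_real (r0\<^sup>2)"
      using True complex_div_cnj[of v w0] by simp
    moreover have "Re (v / w0) = - (1 + 2 * \<kappa>) / r0"
    proof -
      have "Re (- of_real r0 * v / w0) = - r0 * Re (v / w0)"
        by (metis Re_complex_of_real Im_complex_of_real mult_zero_left diff_zero minus_complex.simps times_complex.simps(1) times_divide_eq_right of_real_minus)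
      then show ?thesis using r0 by (simp add: \<kappa>_def field_simps)
    qed
    ultimately have "Re (v * cnj w0) / r0\<^sup>2 = - (1 + 2 * \<kappa>) / r0"
      by (metis Re_divide_of_real)
    then have vw: "Re (v * cnj w0) = - r0 * (1 + 2 * \<kappa>)"
      using r0 by (simp add: divide_eq_eq power2_eq_square) (simp add: algebra_simps)
    have "norm (w0 + of_real \<epsilon> * v) \<le> r0 - \<epsilon> * (1 + \<kappa>)"
      if \<epsilon>: "0 < \<epsilon>" "\<epsilon> < min (2 * r0 * \<kappa> / ((norm v)\<^sup>2 + 1)) (r0 / (1 + \<kappa>))" for \<epsilon>
    proof (rule power2_le_imp_le)
      have "\<epsilon> * ((norm v)\<^sup>2 + 1) \<le> 2 * r0 * \<kappa>"
        using \<epsilon> pos_less_divide_eq[of "(norm v)\<^sup>2 + 1" \<epsilon> "2 * r0 * \<kappa>"] by (simp add: add_nonneg_pos)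
      then have "\<epsilon> * (norm v)\<^sup>2 \<le> 2 * r0 * \<kappa>"
        using \<epsilon> by (simp add: algebra_simps)
      then have *: "\<epsilon> * (\<epsilon> * (norm v)\<^sup>2) \<le> \<epsilon> * (2 * r0 * \<kappa>)"
        using \<epsilon> by (intro mult_left_mono) auto
      have "(norm (w0 + of_real \<epsilon> * v))\<^sup>2 = (norm w0)\<^sup>2 + \<epsilon>\<^sup>2 * (norm v)\<^sup>2 + 2 * \<epsilon> * Re (v * cnj w0)"
        unfolding cmod_power2 by (simp add: power2_eq_square algebra_simps)
      also have "\<dots> = r0\<^sup>2 - 2 * \<epsilon> * r0 * (1 + 2 * \<kappa>) + \<epsilon> * (\<epsilon> * (norm v)\<^sup>2)"
        unfolding True vw by (simp add: power2_eq_square algebra_simps)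
      also have "\<dots> \<le> r0\<^sup>2 - 2 * \<epsilon> * r0 * (1 + \<kappa>)"
        using * by (simp add: algebra_simps)
      also have "\<dots> \<le> (r0 - \<epsilon> * (1 + \<kappa>))\<^sup>2"
        by (simp add: power2_diff algebra_simps)
      finally show "(norm (w0 + of_real \<epsilon> * v))\<^sup>2 \<le> (r0 - \<epsilon> * (1 + \<kappa>))\<^sup>2" .
      show "0 \<le> r0 - \<epsilon> * (1 + \<kappa>)" using \<epsilon> \<open>\<kappa> > 0\<close> by (simp add: field_simps)
    qed
    moreover have "min (2 * r0 * \<kappa> / ((norm v)\<^sup>2 + 1)) (r0 / (1 + \<kappa>)) > 0"
      using r0 \<open>\<kappa> > 0\<close> by (simp add: add_nonneg_pos)
    ultimately show ?thesis
      unfolding eventually_at_right_field using \<open>\<kappa> > 0\<close> by blast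
  next
    case False
    then have lt: "norm w0 < r0" using r0 by simp
    have "((\<lambda>\<epsilon>::real. norm (w0 + of_real \<epsilon> * v) + \<epsilon> * (1 + 1)) \<longlongrightarrow> norm (w0 + of_real 0 * v) + 0 * (1 + 1)) (at_right 0)"
      by (intro tendsto_intros)
    from order_tendstoD(2)[OF this, of r0] lt
    have "\<forall>\<^sub>F \<epsilon> in at_right 0. norm (w0 + of_real \<epsilon> * v) + \<epsilon> * (1 + 1) < r0" by simp
    then have "\<forall>\<^sub>F \<epsilon> in at_right 0. norm (w0 + of_real \<epsilon> * v) \<le> r0 - \<epsilon> * (1 + 1)"
      by eventually_elim simp
    then show ?thesis by (intro exI[of _ 1]) auto
  qed
  then obtain \<kappa> where "\<kappa> > 0"
    and \<kappa>: "\<forall>\<^sub>F \<epsilon> in at_right 0. norm (w0 + of_real \<epsilon> * v) \<le> r0 - \<epsilon> * (1 + \<kappa>)" by blast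
  have "((\<lambda>\<epsilon>::real. norm (of_real \<epsilon> * v) + \<kappa> * \<epsilon>) \<longlongrightarrow> norm (of_real 0 * v) + \<kappa> * 0) (at_right 0)"
    by (intro tendsto_intros)
  from order_tendstoD(2)[OF this, of \<delta>] \<open>\<delta> > 0\<close>
  have \<delta>: "\<forall>\<^sub>F \<epsilon> in at_right 0. norm (of_real \<epsilon> * v) + \<kappa> * \<epsilon> < \<delta>" by simp
  have "w0 \<in> ball 0 1" using r0 by simp
  from perturbed_preimage[OF open_ball this hol A D v_def \<open>\<kappa> > 0\<close>] \<kappa> \<delta>
  show ?thesis
  proof eventually_elim
    case (elim \<epsilon>)
    then obtain w where w: "w \<in> cball (w0 + of_real \<epsilon> * v) (\<kappa> * \<epsilon>)"
      "F w + A (r0 - \<epsilon>) * H w = F w0 + A r0 * H w0" by blast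
    have "norm (w - (w0 + of_real \<epsilon> * v)) \<le> \<kappa> * \<epsilon>"
      using w(1) by (simp add: dist_norm norm_minus_commute)
    moreover have "norm w \<le> norm (w - (w0 + of_real \<epsilon> * v)) + norm (w0 + of_real \<epsilon> * v)"
      using norm_triangle_ineq[of "w - (w0 + of_real \<epsilon> * v)" "w0 + of_real \<epsilon> * v"] by simp
    moreover have "norm (w - w0) \<le> norm (w - (w0 + of_real \<epsilon> * v)) + norm (of_real \<epsilon> * v)"
      using norm_triangle_ineq[of "w - (w0 + of_real \<epsilon> * v)" "of_real \<epsilon> * v"] by simp
    ultimately have "norm w \<le> r0 - \<epsilon>" "norm (w - w0) < \<delta>"
      using elim by (auto simp: algebra_simps)
    with w show ?case by (auto simp: dist_norm norm_minus_commute)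
  qed
qed

section \<open>The continuity argument in the radius\<close>

text \<open>Let \<open>r0\<close> be the infimum of the radii at which the chain is not injective.
  It is positive because \<open>A\<close> blows up at 0. It is not itself bad, since a collision
  could be pushed inward to a smaller radius. Bad radii cannot accumulate at it from above, since
  the colliding pairs would merge at a point where the derivative is nonzero. So every radius below
  1 is good, and Hurwitz' theorem passes injectivity to \<open>F\<close> as \<open>A\<close> tends
  to 0.\<close>

theorem inj_on_unit_disk_by_chain:
  fixes F H :: "complex \<Rightarrow> complex" and A A' :: "real \<Rightarrow> complex"
  assumes hol: "F holomorphic_on ball 0 1" "H holomorphic_on ball 0 1"
    and F0: "deriv F 0 \<noteq> 0" and H0: "deriv H 0 \<noteq> 0"
    and A: "\<And>r. 0 < r \<Longrightarrow> r < 1 \<Longrightarrow> (A has_vector_derivative A' r) (at r)"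
    and A0: "filterlim A at_infinity (at_right 0)"
    and A1: "(A \<longlongrightarrow> 0) (at_left 1)"
    and nz: "\<And>r w. 0 < r \<Longrightarrow> r < 1 \<Longrightarrow> norm w \<le> r \<Longrightarrow> deriv F w + A r * deriv H w \<noteq> 0"
    and inward: "\<And>r w. 0 < r \<Longrightarrow> r < 1 \<Longrightarrow> norm w = r \<Longrightarrow>
       Re (- of_real r * A' r * H w / (w * (deriv F w + A r * deriv H w))) > 1"
  shows "inj_on F (ball 0 1)"
proof -
  define \<Phi> where "\<Phi> = (\<lambda>r w. F w + A r * H w)"
  define \<Phi>' where "\<Phi>' = (\<lambda>r w. deriv F w + A r * deriv H w)"
  define good where "good = (\<lambda>r. inj_on (\<Phi> r) (cball 0 r))"
  have der: "(\<Phi> r has_field_derivative \<Phi>' r w) (at w within X)" if "norm w < 1" for r w X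
  proof -
    have "w \<in> ball 0 1" using that by simp
    from holomorphic_derivI[OF hol(1) open_ball this] holomorphic_derivI[OF hol(2) open_ball this]
    show ?thesis
      unfolding \<Phi>_def \<Phi>'_def by (intro DERIV_add DERIV_cmult) (auto intro: has_field_derivative_at_within)
  qed
  have cF': "isCont (deriv F) w" and cH': "isCont (deriv H) w" 
    and cF: "isCont F w" and cH: "isCont H w" if "norm w < 1" for w
    using that hol
    by (auto intro!: continuous_on_interior[of "ball 0 1"] holomorphic_on_imp_continuous_on holomorphic_deriv)

  have small: "\<exists>\<rho>>0. \<forall>r. 0 < r \<and> r < \<rho> \<longrightarrow> good r"
  proof -
    let ?h = "norm (deriv H 0)"
    have "\<forall>\<^sub>F w in nhds 0. dist (deriv H w) (deriv H 0) < ?h / 4"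
      using cH'[of 0] H0 by (intro tendstoD) (auto simp: isCont_def tendsto_nhds_iff)
    moreover have "\<forall>\<^sub>F w in nhds 0. dist (deriv F w) (deriv F 0) < 1"
      using cF'[of 0] by (intro tendstoD) (auto simp: isCont_def tendsto_nhds_iff)
    ultimately have "\<forall>\<^sub>F w in nhds 0. dist (deriv H w) (deriv H 0) < ?h / 4 \<and> dist (deriv F w) (deriv F 0) < 1"
      by eventually_elim auto
    then obtain d where "d > 0" and d: "\<And>w. norm w < d \<Longrightarrow> norm (deriv H w - deriv H 0) < ?h / 4"
        "\<And>w. norm w < d \<Longrightarrow> norm (deriv F w - deriv F 0) < 1"
      unfolding eventually_nhds_metric by (auto simp: dist_norm)
    \<comment> \<open>\<open>M\<close> bounds F' near 0. Once \<open>norm (A r)\<close> exceeds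
      \<open>4 * M / ?h\<close>, F' contributes at most a quarter of \<open>norm (A r) * ?h\<close>;
      the oscillation of H' contributes another quarter, which together make the half allowed by
      \<open>inj_on_if_deriv_near_constant\<close>.\<close>
    define M where "M = norm (deriv F 0) + 1"
    have M: "norm (deriv F w) \<le> M" if "norm w < d" for w
      using d(2)[OF that] norm_triangle_ineq2[of "deriv F w" "deriv F 0"] by (simp add: M_def)
    have "\<forall>\<^sub>F r in at_right 0. norm (A r) \<ge> 4 * M / ?h + 1"
      using A0 unfolding filterlim_at_infinity[OF order_refl]
      by (auto simp: M_def add_nonneg_pos intro!: add_nonneg_pos)
    then obtain b where "b > 0" and b: "\<And>r. 0 < r \<Longrightarrow> r < b \<Longrightarrow> norm (A r) \<ge> 4 * M / ?h + 1"
      unfolding eventually_at_right_field by auto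
    show ?thesis
    proof (intro exI[of _ "min 1 (min b d)"] conjI allI impI)
      fix r assume r: "0 < r \<and> r < min 1 (min b d)"
      have "4 * M / ?h + 1 > 0" by (auto simp: M_def intro!: add_nonneg_pos)
      with b[of r] r have "A r \<noteq> 0" by auto
      have "4 * M / ?h \<le> norm (A r)" using b[of r] r by simp
      then have 4: "4 * M \<le> norm (A r) * ?h" using H0 by (simp add: field_simps)
      show "good r" unfolding good_def
      proof (rule inj_on_if_deriv_near_constant[OF convex_cball der])
        fix w :: complex assume "w \<in> cball 0 r"
        then have w: "norm w < d" "norm w < 1" using r by auto
        show "norm w < 1" by fact
        have "\<Phi>' r w - A r * deriv H 0 = deriv F w + A r * (deriv H w - deriv H 0)"
          by (simp add: \<Phi>'_def algebra_simps)
        then have "norm (\<Phi>' r w - A r * deriv H 0) \<le> norm (deriv F w) + norm (A r) * norm (deriv H w - deriv H 0)"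
          by (metis norm_mult norm_triangle_ineq)
        also have "\<dots> \<le> norm (A r) * ?h / 4 + norm (A r) * (?h / 4)"
          using M[OF w(1)] 4 d(1)[OF w(1)] by (intro add_mono mult_left_mono) auto
        finally show "norm (\<Phi>' r w - A r * deriv H 0) \<le> norm (A r * deriv H 0) / 2"
          by (simp add: norm_mult)
      qed (use H0 \<open>A r \<noteq> 0\<close> in auto)
    qed (use \<open>b > 0\<close> \<open>d > 0\<close> in auto)
  qed

  have good: "good r" if "0 < r" "r < 1" for r
  proof (rule ccontr)
    assume bad: "\<not> good r"
    define S where "S = {r. 0 < r \<and> r < 1 \<and> \<not> good r}"
    have "r \<in> S" using that bad by (simp add: S_def)
    define r0 where "r0 = Inf S"
    obtain \<rho> where \<rho>: "\<rho> > 0" "\<And>r. 0 < r \<Longrightarrow> r < \<rho> \<Longrightarrow> good r" using small by blast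
    have bdd: "bdd_below S" by (auto simp: S_def intro!: bdd_belowI[of _ 0])
    have "\<rho> \<le> r0" unfolding r0_def using \<open>r \<in> S\<close> \<rho>(2)
      by (intro cInf_greatest) (auto simp: S_def not_less[symmetric])
    then have "0 < r0" using \<rho> by simp
    have "r0 < 1" using cInf_lower[OF \<open>r \<in> S\<close> bdd] that by (simp add: r0_def)
    have below: "good s" if "0 < s" "s < r0" for s
      using cInf_lower[OF _ bdd, of s] that \<open>r0 < 1\<close> by (force simp: S_def r0_def)

    \<comment> \<open>Half the distance of the colliding points serves as \<open>\<delta>\<close>,
      so the preimages pushed inward lie in disjoint balls and form a collision at a radius below
      \<open>r0\<close>.\<close>
    have "good r0" unfolding good_def
    proof (rule inj_onI, rule ccontr)
      fix z1 z2 assume z: "z1 \<in> cball 0 r0" "z2 \<in> cball 0 r0" "\<Phi> r0 z1 = \<Phi> r0 z2" "z1 \<noteq> z2"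
      define \<delta> where "\<delta> = dist z1 z2 / 2"
      have "\<delta> > 0" using z by (simp add: \<delta>_def)
      have *: "\<forall>\<^sub>F \<epsilon> in at_right 0. \<exists>w \<in> ball z \<delta>. norm w \<le> r0 - \<epsilon> \<and> \<Phi> (r0 - \<epsilon>) w = \<Phi> r0 z"
        if "z \<in> cball 0 r0" for z
        unfolding \<Phi>_def using that \<open>0 < r0\<close> \<open>r0 < 1\<close> \<open>\<delta> > 0\<close>
        by (intro preimage_moves_inward[OF hol A _ _ _ _ refl] nz inward) auto
      have "\<forall>\<^sub>F \<epsilon> in at_right 0. 0 < \<epsilon> \<and> \<epsilon> < r0"
        using \<open>0 < r0\<close> unfolding eventually_at_right_field by blast
      with *[OF z(1)] *[OF z(2)] have "\<forall>\<^sub>F \<epsilon> in at_right (0::real). False"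
      proof eventually_elim
        case (elim \<epsilon>)
        then obtain w1 w2 where w: "w1 \<in> ball z1 \<delta>" "norm w1 \<le> r0 - \<epsilon>" "\<Phi> (r0 - \<epsilon>) w1 = \<Phi> r0 z1"
          "w2 \<in> ball z2 \<delta>" "norm w2 \<le> r0 - \<epsilon>" "\<Phi> (r0 - \<epsilon>) w2 = \<Phi> r0 z2" by blast
        have "good (r0 - \<epsilon>)" using below[of "r0 - \<epsilon>"] elim(3) by simp
        moreover have "\<Phi> (r0 - \<epsilon>) w1 = \<Phi> (r0 - \<epsilon>) w2" using w(3,6) z(3) by simp
        ultimately have "w1 = w2"
          unfolding good_def by (rule inj_onD) (use w in simp_all)
        then show False
          using w dist_triangle2[of z1 z2 w1] by (simp add: \<delta>_def)
      qed
      then show False by simp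
    qed

    \<comment> \<open>Were \<open>r0\<close> an infimum of bad radii, these would approach it from
      above; one colliding pair is chosen for each of them.\<close>
    have "\<exists>s z z'. s \<ge> r0 \<and> s < r0 + inverse (Suc n) \<and> s < 1 \<and> norm z \<le> s \<and> norm z' \<le> s \<and>
             z \<noteq> z' \<and> \<Phi> s z = \<Phi> s z'" for n
    proof -
      obtain s where "s \<in> S" "s < r0 + inverse (Suc n)"
        using cInf_lessD[of S "r0 + inverse (Suc n)"] \<open>r \<in> S\<close> by (auto simp: r0_def)
      moreover have "r0 \<le> s" using cInf_lower[OF \<open>s \<in> S\<close> bdd] by (simp add: r0_def)
      moreover from \<open>s \<in> S\<close> obtain x y where "norm x \<le> s" "norm y \<le> s" "x \<noteq> y" "\<Phi> s x = \<Phi> s y" "s < 1"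
        by (auto simp: S_def good_def inj_on_def)
      ultimately show ?thesis by blast
    qed
    then obtain s z z' where s: "\<And>n. s n \<ge> r0" "\<And>n. s n < r0 + inverse (Suc n)" "\<And>n. s n < 1"
      and z: "\<And>n. norm (z n) \<le> s n" "\<And>n. norm (z' n) \<le> s n" "\<And>n. z n \<noteq> z' n"
        "\<And>n. \<Phi> (s n) (z n) = \<Phi> (s n) (z' n)" by metis
    have s_lim: "s \<longlonglongrightarrow> r0"
    proof (rule tendsto_sandwich[of "\<lambda>_. r0" _ _ "\<lambda>n. r0 + inverse (real (Suc n))"])
      show "(\<lambda>n. r0 + inverse (real (Suc n))) \<longlonglongrightarrow> r0"
        using tendsto_add[OF tendsto_const LIMSEQ_inverse_real_of_nat, of r0] by simp
      show "\<forall>\<^sub>F n in sequentially. r0 \<le> s n" using s(1) by simp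
      show "\<forall>\<^sub>F n in sequentially. s n \<le> r0 + inverse (real (Suc n))"
        using s(2) by (intro always_eventually allI less_imp_le)
    qed (rule tendsto_const)
    have "compact (cball (0::complex) 1 \<times> cball (0::complex) 1)"
      by (intro compact_Times compact_cball)
    moreover have "(z n, z' n) \<in> cball 0 1 \<times> cball 0 1" for n
      using z(1)[of n] z(2)[of n] s(3)[of n] by simp
    ultimately obtain l k where k: "strict_mono k" "((\<lambda>n. (z n, z' n)) \<circ> k) \<longlonglongrightarrow> l"
      unfolding compact_def by meson
    have sk: "(\<lambda>n. s (k n)) \<longlonglongrightarrow> r0"
      using LIMSEQ_subseq_LIMSEQ[OF s_lim k(1)] by (simp add: o_def)
    have zk: "(\<lambda>n. z (k n)) \<longlonglongrightarrow> fst l" and zk': "(\<lambda>n. z' (k n)) \<longlonglongrightarrow> snd l"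
      using tendsto_fst[OF k(2)] tendsto_snd[OF k(2)] by (simp_all add: o_def)
    have l: "norm (fst l) \<le> r0" "norm (snd l) \<le> r0"
      by (rule tendsto_le[OF _ sk tendsto_norm[OF zk]] tendsto_le[OF _ sk tendsto_norm[OF zk']];
          use z in simp)+
    have cA: "isCont A r0"
      using A[OF \<open>0 < r0\<close> \<open>r0 < 1\<close>] by (rule has_vector_derivative_continuous)
    have "(\<lambda>n. \<Phi> (s (k n)) (z (k n))) \<longlonglongrightarrow> \<Phi> r0 (fst l)"
      unfolding \<Phi>_def using l \<open>r0 < 1\<close>
      by (intro tendsto_intros isCont_tendsto_compose[OF cA sk] isCont_tendsto_compose[OF cF zk] isCont_tendsto_compose[OF cH zk]) auto
    moreover have "(\<lambda>n. \<Phi> (s (k n)) (z' (k n))) \<longlonglongrightarrow> \<Phi> r0 (snd l)"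
      unfolding \<Phi>_def using l \<open>r0 < 1\<close>
      by (intro tendsto_intros isCont_tendsto_compose[OF cA sk] isCont_tendsto_compose[OF cF zk'] isCont_tendsto_compose[OF cH zk']) auto
    ultimately have "\<Phi> r0 (fst l) = \<Phi> r0 (snd l)"
      unfolding z(4) by (rule LIMSEQ_unique)
    \<comment> \<open>Both limit points have the same image under the chain at \<open>r0\<close>,
      which is injective; so the two members of the pairs converge to one point.\<close>
    with \<open>good r0\<close> l have l_eq: "snd l = fst l"
      by (auto simp: good_def inj_on_def)

    define p where "p = fst l"
    have p: "norm p \<le> r0" "norm p < 1" using l \<open>r0 < 1\<close> by (auto simp: p_def)
    define d where "d = \<Phi>' r0 p"
    have "d \<noteq> 0" using nz[of r0 p] p \<open>0 < r0\<close> \<open>r0 < 1\<close> by (simp add: d_def \<Phi>'_def)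
    \<comment> \<open>Joint continuity keeps the derivative near \<open>d\<close> for all radii near
      \<open>r0\<close> and all points near \<open>p\<close>. Hence one ball around \<open>p\<close>
      serves as a set of injectivity for all these radii at once, and it eventually contains the
      colliding pairs.\<close>
    have "((\<lambda>x. \<Phi>' (fst x) (snd x)) \<longlongrightarrow> d) (nhds r0 \<times>\<^sub>F nhds p)"
      unfolding \<Phi>'_def d_def
      using cA cF'[OF p(2)] cH'[OF p(2)]
      by (intro tendsto_intros filterlim_compose[OF _ filterlim_fst] filterlim_compose[OF _ filterlim_snd])
         (auto simp: isCont_def tendsto_nhds_iff)
    from tendstoD[OF this, of "norm d / 2"] \<open>d \<noteq> 0\<close>
    obtain P Q where P: "eventually P (nhds r0)" and Q: "eventually Q (nhds p)"
      and PQ: "\<And>x y. P x \<Longrightarrow> Q y \<Longrightarrow> dist (\<Phi>' x y) d < norm d / 2"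
      unfolding eventually_prod_filter by auto
    have "eventually (\<lambda>y. norm y < 1) (nhds p)"
      using p by (intro order_tendstoD[OF tendsto_norm[OF filterlim_ident]]) 
    with Q have "eventually (\<lambda>y. Q y \<and> norm y < 1) (nhds p)" by eventually_elim auto
    then obtain e where e: "e > 0" "\<And>y. y \<in> ball p e \<Longrightarrow> Q y \<and> norm y < 1"
      unfolding eventually_nhds_metric by (auto simp: dist_commute)
    have ev: "\<forall>\<^sub>F n in sequentially. z (k n) \<in> ball p e" "\<forall>\<^sub>F n in sequentially. z' (k n) \<in> ball p e"
      using tendstoD[OF zk e(1)] tendstoD[OF zk' e(1)] l_eq by (simp_all add: p_def dist_commute)
    have "\<forall>\<^sub>F n in sequentially. P (s (k n))"
      using sk P by (simp add: filterlim_iff)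
    with ev have "\<forall>\<^sub>F n in sequentially. False"
    proof eventually_elim
      case (elim n)
      have "inj_on (\<Phi> (s (k n))) (ball p e)"
      proof (rule inj_on_if_deriv_near_constant[OF convex_ball der])
        fix y assume "y \<in> ball p e"
        with e(2) have "Q y" "norm y < 1" by auto
        then show "norm y < 1" "norm (\<Phi>' (s (k n)) y - d) \<le> norm d / 2"
          using PQ[OF elim(3) \<open>Q y\<close>] by (auto simp: dist_norm)
      qed fact
      from inj_onD[OF this z(4) elim(1,2)] z(3) show False by blast
    qed
    then show False by simp
  qed

  show ?thesis
  proof (rule inj_onI)
    fix z1 z2 assume z: "z1 \<in> ball 0 1" "z2 \<in> ball 0 1" "F z1 = F z2"
    define m where "m = max (norm z1) (norm z2)"
    have "m < 1" "m \<ge> 0" using z by (auto simp: m_def le_max_iff_disj)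
    define \<rho> where "\<rho> = (m + 1) / 2"
    have \<rho>: "m < \<rho>" "\<rho> < 1" "0 < \<rho>" using \<open>m < 1\<close> \<open>m \<ge> 0\<close> by (auto simp: \<rho>_def)
    \<comment> \<open>The radii tend to 1 but never fall below \<open>\<rho>\<close>, so each
      \<open>\<Phi> (r n)\<close> is injective on \<open>ball 0 \<rho>\<close>, where Hurwitz'
      theorem is applied.\<close>
    define r where "r = (\<lambda>n. 1 - (1 - \<rho>) * inverse (real (Suc n)))"
    have r: "\<rho> \<le> r n" "r n < 1" for n
    proof -
      have "(1 - \<rho>) * inverse (real (Suc n)) \<le> (1 - \<rho>) * 1"
        using \<rho> by (intro mult_left_mono) (auto simp: field_simps)
      then show "\<rho> \<le> r n" by (simp add: r_def)
      show "r n < 1" using \<rho> by (simp add: r_def)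
    qed
    have "r \<longlonglongrightarrow> 1 - (1 - \<rho>) * 0"
      unfolding r_def by (intro tendsto_intros LIMSEQ_inverse_real_of_nat)
    then have "filterlim r (at_left 1) sequentially"
      using r(2) by (auto simp: filterlim_at less_imp_neq)
    then have Ar: "(\<lambda>n. A (r n)) \<longlonglongrightarrow> 0"
      using A1 filterlim_compose by blast
    have sub: "ball 0 \<rho> \<subseteq> ball (0::complex) 1" using \<rho> by auto
    have "inj_on F (ball 0 \<rho>)"
    proof (rule Hurwitz_injective[OF open_ball connected_ball])
      show "\<Phi> (r n) holomorphic_on ball 0 \<rho>" for n
        unfolding \<Phi>_def using sub by (intro holomorphic_intros hol[THEN holomorphic_on_subset])
      show "F holomorphic_on ball 0 \<rho>" using hol(1) sub by (rule holomorphic_on_subset)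
      show "inj_on (\<Phi> (r n)) (ball 0 \<rho>)" for n
        using good[of "r n"] r[of n] \<rho> unfolding good_def by (auto intro: inj_on_subset)
      show "\<not> F constant_on ball 0 \<rho>"
      proof
        assume "F constant_on ball 0 \<rho>"
        then obtain c where c: "\<And>w. w \<in> ball 0 \<rho> \<Longrightarrow> F w = c" by (auto simp: constant_on_def)
        have "(F has_field_derivative 0) (at 0)"
          by (rule has_field_derivative_transform_within_open[OF DERIV_const[of c] open_ball[of 0 \<rho>]])
             (use c \<rho> in auto)
        then show False using F0 DERIV_imp_deriv by blast
      qed
      fix K :: "complex set" assume K: "compact K" "K \<subseteq> ball 0 \<rho>"
      have "bounded (H ` K)"
        using K sub by (intro compact_imp_bounded compact_continuous_image holomorphic_on_imp_continuous_on
              holomorphic_on_subset[OF hol(2)]) auto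
      then obtain B where B: "B > 0" "\<And>w. w \<in> K \<Longrightarrow> norm (H w) \<le> B"
        unfolding bounded_pos by auto
      show "uniform_limit K (\<lambda>n. \<Phi> (r n)) F sequentially"
      proof (rule uniform_limitI)
        fix e :: real assume "e > 0"
        then have "\<forall>\<^sub>F n in sequentially. dist (A (r n)) 0 < e / B"
          using B by (intro tendstoD[OF Ar]) auto
        then show "\<forall>\<^sub>F n in sequentially. \<forall>x\<in>K. dist (\<Phi> (r n) x) (F x) < e"
        proof eventually_elim
          case (elim n)
          show ?case
          proof
            fix x assume "x \<in> K"
            have "norm (A (r n)) * norm (H x) \<le> norm (A (r n)) * B"
              using B(2)[OF \<open>x \<in> K\<close>] by (intro mult_left_mono) auto
            also have "\<dots> < e" using elim B by (simp add: field_simps)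
            finally show "dist (\<Phi> (r n) x) (F x) < e"
              by (simp add: \<Phi>_def dist_norm norm_mult)
          qed
        qed
      qed
    qed
    then show "z1 = z2"
      using z \<rho> by (auto simp: inj_on_def m_def)
  qed
qed

section \<open>Convex functions\<close>

text \<open>The Schwarz lemma applies to the rescaled map
  \<open>\<lambda>\<zeta>. \<omega> (of_real R * \<zeta>)\<close>. The circle of radius
  \<open>R\<close>, where Jack's lemma needs the bound, is reached by continuity along
  radii.\<close>

lemma Schwarz_closed_disc:
  assumes hol: "\<omega> holomorphic_on ball 0 1" and "\<omega> 0 = 0"
    and R: "0 < R" "R < 1" and lt: "\<And>z. norm z < R \<Longrightarrow> norm (\<omega> z) < 1"
    and z: "norm z \<le> R"
  shows "norm (\<omega> z) \<le> norm z / R"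
proof -
  have open_case: "norm (\<omega> z) \<le> norm z / R" if "norm z < R" for z
  proof -
    have "norm ((\<lambda>\<zeta>. \<omega> (of_real R * \<zeta>)) (z / of_real R)) \<le> norm (z / of_real R)"
    proof (rule Schwarz_Lemma(1))
      have "(\<omega> \<circ> (\<lambda>\<zeta>. of_real R * \<zeta>)) holomorphic_on ball 0 1"
      proof (intro holomorphic_on_compose_gen[OF _ hol] holomorphic_intros)
        have "of_real R * \<zeta> \<in> ball 0 1" if "\<zeta> \<in> ball 0 1" for \<zeta> :: complex
        proof -
          have "R * norm \<zeta> \<le> 1 * norm \<zeta>" using R by (intro mult_right_mono) auto
          then show ?thesis using R that by (simp add: norm_mult)
        qed
        then show "(\<lambda>\<zeta>. of_real R * \<zeta>) ` ball 0 1 \<subseteq> ball (0::complex) 1" by blast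
      qed
      then show "(\<lambda>\<zeta>. \<omega> (of_real R * \<zeta>)) holomorphic_on ball 0 1" by (simp add: o_def)
      show "norm (\<omega> (of_real R * \<zeta>)) < 1" if "norm \<zeta> < 1" for \<zeta>
        using that R by (intro lt) (simp add: norm_mult)
      show "norm (z / of_real R) < 1" using that R by (simp add: norm_divide)
    qed (use \<open>\<omega> 0 = 0\<close> in simp)
    then show ?thesis using R by (simp add: norm_divide)
  qed
  have "norm z < 1" using z R by simp
  then have "isCont \<omega> z"
    using hol by (intro continuous_on_interior[of "ball 0 1"] holomorphic_on_imp_continuous_on) auto
  moreover have "((\<lambda>s::real. of_real s * z) \<longlongrightarrow> of_real 1 * z) (at_left 1)"
    by (intro tendsto_intros)
  then have "((\<lambda>s::real. of_real s * z) \<longlongrightarrow> z) (at_left 1)" by simp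
  ultimately have "((\<lambda>s::real. norm (\<omega> (of_real s * z))) \<longlongrightarrow> norm (\<omega> z)) (at_left 1)"
    by (rule tendsto_norm[OF isCont_tendsto_compose])
  moreover have "((\<lambda>s::real. s * norm z / R) \<longlongrightarrow> 1 * norm z / R) (at_left 1)"
    using R by (intro tendsto_intros) auto
  moreover have "\<forall>\<^sub>F s in at_left (1::real). norm (\<omega> (of_real s * z)) \<le> s * norm z / R"
  proof -
    have "\<forall>\<^sub>F s in at_left (1::real). 0 < s \<and> s < 1"
      unfolding eventually_at_left_field by (intro exI[of _ 0]) auto
    then show ?thesis
    proof eventually_elim
      case (elim s)
      show ?case
      proof (cases "z = 0")
        case True
        then show ?thesis using \<open>\<omega> 0 = 0\<close> by simp
      next
        case False
        then have "s * norm z < 1 * norm z" using elim by (intro mult_strict_right_mono) auto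
        then have "norm (of_real s * z) < R" using elim z by (simp add: norm_mult)
        from open_case[OF this] show ?thesis using elim by (simp add: norm_mult)
      qed
    qed
  qed
  ultimately show ?thesis using tendsto_le[OF trivial_limit_at_left_real] by fastforce
qed

lemma has_real_derivative_norm_power2:
  fixes f :: "real \<Rightarrow> complex"
  assumes "(f has_vector_derivative f') (at s)"
  shows "((\<lambda>s. (norm (f s))\<^sup>2) has_real_derivative 2 * Re (cnj (f s) * f')) (at s)"
proof -
  have "((\<lambda>s. Re (f s)) has_real_derivative Re f') (at s)"
    "((\<lambda>s. Im (f s)) has_real_derivative Im f') (at s)"
    using bounded_linear.has_vector_derivative[OF bounded_linear_Re assms]
      bounded_linear.has_vector_derivative[OF bounded_linear_Im assms]
    by (simp_all add: has_real_derivative_iff_has_vector_derivative)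
  then show ?thesis
    unfolding cmod_power2
    by (rule DERIV_cong[OF DERIV_add[OF DERIV_power[where n = 2] DERIV_power[where n = 2]]]) (simp add: algebra_simps)
qed

text \<open>\<open>z0\<close> is a first point at which \<open>\<omega>\<close> leaves the unit
  disc. The Schwarz bound is attained there, so first-order comparison in every direction that does
  not lead outward restricts the logarithmic derivative.\<close>

lemma Jack_lemma:
  assumes hol: "\<omega> holomorphic_on ball 0 1" and "\<omega> 0 = 0"
    and z0: "z0 \<in> ball 0 1" "norm (\<omega> z0) \<ge> 1"
    and lt: "\<And>z. norm z < norm z0 \<Longrightarrow> norm (\<omega> z) < 1"
  obtains k where "k \<ge> 1" "z0 * deriv \<omega> z0 = of_real k * \<omega> z0" "norm (\<omega> z0) = 1"
proof -
  define R where "R = norm z0"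
  have "z0 \<noteq> 0" using z0 \<open>\<omega> 0 = 0\<close> by auto
  then have R: "0 < R" "R < 1" using z0 by (auto simp: R_def)
  have Schwarz: "norm (\<omega> z) \<le> norm z / R" if "norm z \<le> R" for z
    using Schwarz_closed_disc[OF hol \<open>\<omega> 0 = 0\<close> R lt that] by (simp add: R_def)
  have n1: "norm (\<omega> z0) = 1" using Schwarz[of z0] z0 R by (simp add: R_def)
  define m where "m = cnj (\<omega> z0) * (z0 * deriv \<omega> z0)"
  \<comment> \<open>|\<omega>(z0 exp(s \<zeta>))| \<le> exp(s Re \<zeta>) for s \<ge> 0 by Schwarz, with equality at s = 0: compare derivatives.\<close>
  have dir: "Re (m * \<zeta>) \<le> Re \<zeta>" if "Re \<zeta> \<le> 0" for \<zeta>
  proof (rule ccontr)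
    assume neg: "\<not> Re (m * \<zeta>) \<le> Re \<zeta>"
    define \<phi> where "\<phi> = (\<lambda>s::real. exp (2 * s * Re \<zeta>) - (norm (\<omega> (z0 * exp (of_real s * \<zeta>))))\<^sup>2)"
    have "((\<lambda>s::real. z0 * exp (of_real s * \<zeta>)) has_vector_derivative z0 * \<zeta>) (at 0)"
      by (rule has_vector_derivative_real_field) (auto intro!: derivative_eq_intros)
    from field_vector_diff_chain_at[OF this, of \<omega> "deriv \<omega> z0"]
    have "((\<lambda>s::real. \<omega> (z0 * exp (of_real s * \<zeta>))) has_vector_derivative (z0 * \<zeta> * deriv \<omega> z0)) (at 0)"
      using holomorphic_derivI[OF hol open_ball z0(1)] by (simp add: o_def)
    from has_real_derivative_norm_power2[OF this]
    have *: "((\<lambda>s::real. (norm (\<omega> (z0 * exp (of_real s * \<zeta>))))\<^sup>2) has_real_derivative 2 * Re (m * \<zeta>)) (at 0)"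
      by (simp add: m_def mult_ac)
    have "((\<lambda>s. exp (2 * s * Re \<zeta>)) has_real_derivative 2 * Re \<zeta>) (at 0)"
      by (auto intro!: derivative_eq_intros)
    from DERIV_diff[OF this *]
    have "(\<phi> has_real_derivative 2 * Re \<zeta> - 2 * Re (m * \<zeta>)) (at 0)"
      unfolding \<phi>_def .
    then obtain d where d: "d > 0" "\<And>h. h > 0 \<Longrightarrow> h < d \<Longrightarrow> \<phi> (0 + h) < \<phi> 0"
      using DERIV_neg_dec_right[of \<phi> "2 * Re \<zeta> - 2 * Re (m * \<zeta>)" 0] neg by fastforce
    define h where "h = d / 2"
    have "h > 0" "h < d" using d(1) by (auto simp: h_def)
    have "h * Re \<zeta> \<le> 0" using that \<open>h > 0\<close> by (simp add: mult_nonneg_nonpos)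
    have n: "norm (z0 * exp (of_real h * \<zeta>)) = R * exp (h * Re \<zeta>)"
      by (simp add: norm_mult R_def)
    also have "\<dots> \<le> R" using R \<open>h * Re \<zeta> \<le> 0\<close> by simp
    finally have "norm (\<omega> (z0 * exp (of_real h * \<zeta>))) \<le> exp (h * Re \<zeta>)"
      using Schwarz[of "z0 * exp (of_real h * \<zeta>)"] n R by simp
    then have "(norm (\<omega> (z0 * exp (of_real h * \<zeta>))))\<^sup>2 \<le> (exp (h * Re \<zeta>))\<^sup>2"
      by (intro power_mono) auto
    also have "\<dots> = exp (2 * h * Re \<zeta>)"
      by (simp add: exp_double[symmetric] mult.assoc)
    finally have "\<phi> h \<ge> 0" by (simp add: \<phi>_def)
    moreover have "\<phi> 0 = 0" by (simp add: \<phi>_def n1)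
    ultimately show False using d(2)[of h] \<open>h > 0\<close> \<open>h < d\<close> by simp
  qed
  \<comment> \<open>The two tangential directions force \<open>m\<close> to be real; the inward
    radial direction bounds it from below by 1.\<close>
  have "Im m = 0" using dir[of \<i>] dir[of "- \<i>"] by simp
  moreover have "Re m \<ge> 1" using dir[of "-1"] by simp
  moreover have "z0 * deriv \<omega> z0 = m * \<omega> z0"
  proof -
    have "\<omega> z0 * cnj (\<omega> z0) = 1"
      using n1 by (simp add: complex_norm_square[symmetric])
    moreover have "m * \<omega> z0 = (\<omega> z0 * cnj (\<omega> z0)) * (z0 * deriv \<omega> z0)" by (simp add: m_def)
    ultimately show ?thesis by simp
  qed
  ultimately show ?thesis
    using that[of "Re m"] n1 by (metis complex_eq_iff Im_complex_of_real Re_complex_of_real)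
qed


section \<open>Consequences of convexity for the derivative\<close>

text \<open>For a convex function with derivative \<open>exp L\<close>, this is the classical bound
  that the square root of the derivative has real part above 1/2. At a first point where
  \<open>\<omega> = exp (- L / 2) - 1\<close> has modulus 1, Jack's lemma gives
  \<open>Re (1 + z * deriv L z) = 1 - k \<le> 0\<close>, contrary to convexity.\<close>

lemma Marx_Strohhaecker:
  assumes hol: "L holomorphic_on ball 0 1" and L0: "L 0 = 0"
    and P: "\<And>z. z \<in> ball 0 1 \<Longrightarrow> Re (1 + z * deriv L z) > 0" and z: "z \<in> ball 0 1"
  shows "norm (exp (- L z / 2) - 1) < 1"
proof (rule ccontr)
  assume contra: "\<not> ?thesis"
  define \<omega> where "\<omega> = (\<lambda>z. exp (- L z / 2) - 1)"
  have hol': "\<omega> holomorphic_on ball 0 1"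
    unfolding \<omega>_def by (intro holomorphic_intros hol) auto
  have sub: "cball 0 (norm z) \<subseteq> ball (0::complex) 1" using z by auto
  \<comment> \<open>A point of least modulus in this compact set is the first exit point that Jack's
    lemma asks for.\<close>
  define S where "S = cball 0 (norm z) \<inter> (\<lambda>z. norm (\<omega> z)) -` {1..}"
  have "compact S"
  proof -
    have "continuous_on (cball 0 (norm z)) (\<lambda>z. norm (\<omega> z))"
      by (intro continuous_intros holomorphic_on_imp_continuous_on holomorphic_on_subset[OF hol' sub])
    then have "closed S" unfolding S_def
      by (intro continuous_closed_preimage) auto
    moreover have "bounded S" unfolding S_def by (rule bounded_Int) auto
    ultimately show ?thesis by (simp add: compact_eq_bounded_closed)
  qed
  moreover have "z \<in> S" using contra by (simp add: S_def \<omega>_def)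
  ultimately obtain z0 where z0: "z0 \<in> S" "\<And>y. y \<in> S \<Longrightarrow> norm z0 \<le> norm y"
    using continuous_attains_inf[of S norm] by (auto intro: continuous_intros)
  have z0': "z0 \<in> ball 0 1" "norm (\<omega> z0) \<ge> 1" "norm z0 \<le> norm z"
    using z0(1) sub by (auto simp: S_def)
  have "norm (\<omega> y) < 1" if "norm y < norm z0" for y
    using z0(2)[of y] that z0'(3) by (force simp: S_def)
  from Jack_lemma[OF hol' _ z0'(1,2) this]
  obtain k where k: "k \<ge> 1" "z0 * deriv \<omega> z0 = of_real k * \<omega> z0" "norm (\<omega> z0) = 1"
    by (auto simp: \<omega>_def L0)
  have "(\<omega> has_field_derivative (- deriv L z0 / 2) * (1 + \<omega> z0)) (at z0)"
    unfolding \<omega>_def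
    by (auto intro!: derivative_eq_intros holomorphic_derivI[OF hol open_ball z0'(1)])
  then have d: "deriv \<omega> z0 = (- deriv L z0 / 2) * (1 + \<omega> z0)" by (rule DERIV_imp_deriv)
  define u where "u = \<omega> z0"
  define X where "X = - (z0 * deriv L z0) / 2"
  have "1 + u \<noteq> 0" by (simp add: u_def \<omega>_def)
  have uu: "u * cnj u = 1" using k(3) by (simp add: u_def complex_norm_square[symmetric])
  have "X * (1 + u) = of_real k * u" using k(2) d by (simp add: u_def X_def algebra_simps)
  then have "X = of_real k * (u / (1 + u))" using \<open>1 + u \<noteq> 0\<close> by (simp add: field_simps)
  \<comment> \<open>The map \<open>u / (1 + u)\<close> sends the unit circle without -1 into the
    line of real part 1/2.\<close>
  moreover have "u / (1 + u) + cnj (u / (1 + u)) = 1"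
  proof -
    have "1 + cnj u \<noteq> 0" using \<open>1 + u \<noteq> 0\<close> by (metis complex_cnj_add complex_cnj_one complex_cnj_zero_iff)
    then show ?thesis using \<open>1 + u \<noteq> 0\<close> uu by (simp add: field_simps)
  qed
  then have "2 * Re (u / (1 + u)) = 1"
    by (metis Re_complex_of_real complex_add_cnj of_real_1)
  then have "Re (u / (1 + u)) = 1 / 2" by linarith
  ultimately have "Re X = k / 2" by (metis Re_complex_of_real Im_complex_of_real mult_zero_left diff_zero times_complex.simps(1) mult.right_neutral times_divide_eq_right)
  moreover have "Re (1 + z0 * deriv L z0) = 1 - 2 * Re X" by (simp add: X_def)
  ultimately show False using P[OF z0'(1)] k(1) by linarith
qed

text \<open>If the bound fails, the intermediate value theorem along the radius gives a point where
  \<open>\<bar>Im L\<bar>\<close> equals \<open>pi\<close>. There \<open>exp (- L / 2)\<close> is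
  purely imaginary, hence at distance at least 1 from 1, against
  \<open>Marx_Strohhaecker\<close>.\<close>

lemma abs_Im_log_deriv_less_pi:
  assumes hol: "L holomorphic_on ball 0 1" and L0: "L 0 = 0"
    and P: "\<And>z. z \<in> ball 0 1 \<Longrightarrow> Re (1 + z * deriv L z) > 0" and z: "z \<in> ball 0 1"
  shows "\<bar>Im (L z)\<bar> < pi"
proof (rule ccontr)
  assume contra: "\<not> ?thesis"
  have mem: "of_real s * z \<in> ball 0 1" if "0 \<le> s" "s \<le> 1" for s :: real
    using z that by (simp add: norm_mult) (smt (verit) mult_left_le_one_le norm_ge_zero)
  have "continuous_on {0..1} (\<lambda>s::real. L (of_real s * z))"
    by (rule continuous_on_compose2[OF holomorphic_on_imp_continuous_on[OF hol]])
       (use mem in \<open>auto intro!: continuous_intros\<close>)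
  then have "continuous_on {0..1} (\<lambda>s::real. \<bar>Im (L (of_real s * z))\<bar>)"
    by (intro continuous_intros)
  with contra IVT'[of "\<lambda>s::real. \<bar>Im (L (of_real s * z))\<bar>" 0 pi 1]
  obtain s where s: "0 \<le> s" "s \<le> 1" "\<bar>Im (L (of_real s * z))\<bar> = pi" by (auto simp: L0)
  have "Re (exp (- L (of_real s * z) / 2)) = 0"
  proof -
    have "Im (L (of_real s * z)) / 2 = pi / 2 \<or> Im (L (of_real s * z)) / 2 = - (pi / 2)"
      using s(3) by linarith
    then have "cos (Im (L (of_real s * z)) / 2) = 0" by (metis cos_minus cos_pi_half)
    then show ?thesis by (simp add: Re_exp)
  qed
  then have "Re (exp (- L (of_real s * z) / 2) - 1) = -1" by simp
  then have "norm (exp (- L (of_real s * z) / 2) - 1) \<ge> 1"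
    by (metis abs_Re_le_cmod abs_minus_cancel abs_one)
  then show False using Marx_Strohhaecker[OF hol L0 P mem[OF s(1,2)]] by simp
qed

text \<open>The Cayley transform of \<open>P\<close> obeys the Schwarz lemma, which places
  \<open>P z\<close> in an Apollonius disc. Clearing the denominator
  \<open>1 - (norm z)\<^sup>2\<close> gives the shape that occurs in the Ahlfors criterion.\<close>

lemma positive_real_part_disc:
  assumes hol: "P holomorphic_on ball 0 1" and P0: "P 0 = 1"
    and pos: "\<And>z. z \<in> ball 0 1 \<Longrightarrow> Re (P z) > 0" and z: "norm z < 1"
  shows "norm (of_real (1 - (norm z)\<^sup>2) * (P z - 1) - of_real (2 * (norm z)\<^sup>2)) \<le> 2 * norm z"
proof -
  have nz: "P z + 1 \<noteq> 0" if "z \<in> ball 0 1" for z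
  proof
    assume "P z + 1 = 0"
    then have "Re (P z + 1) = 0" by simp
    then show False using pos[OF that] by simp
  qed
  have "norm ((\<lambda>z. (P z - 1) / (P z + 1)) z) \<le> norm z"
  proof (rule Schwarz_Lemma(1))
    show "(\<lambda>z. (P z - 1) / (P z + 1)) holomorphic_on ball 0 1"
      by (intro holomorphic_intros hol) (use nz in auto)
    show "norm ((P z - 1) / (P z + 1)) < 1" if "norm z < 1" for z
    proof -
      have "Re (P z) > 0" using pos that by simp
      then have "(norm (P z - 1))\<^sup>2 < (norm (P z + 1))\<^sup>2"
        unfolding cmod_power2 by (simp add: power2_eq_square algebra_simps)
      then show ?thesis using nz[of z] that
        by (simp add: norm_divide power2_less_imp_less)
    qed
  qed (use P0 z in auto)
  then have "norm (P z - 1) \<le> norm z * norm (P z + 1)"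
    using nz[of z] z by (simp add: norm_divide field_simps)
  then have "(norm (P z - 1))\<^sup>2 \<le> (norm z)\<^sup>2 * (norm (P z + 1))\<^sup>2"
    by (metis norm_ge_zero power_mono power_mult_distrib)
  define q where "q = (norm z)\<^sup>2"
  define x where "x = Re (P z - 1)"
  define y where "y = Im (P z - 1)"
  have Pz: "P z = Complex (x + 1) y" by (simp add: x_def y_def complex_eq_iff)
  have q: "q < 1" using z by (simp add: q_def abs_square_less_1)
  have "x\<^sup>2 + y\<^sup>2 \<le> q * ((x + 2)\<^sup>2 + y\<^sup>2)"
    using \<open>(norm (P z - 1))\<^sup>2 \<le> _\<close> unfolding q_def[symmetric] cmod_power2[of "P z - 1"] cmod_power2[of "P z + 1"]
    by (simp add: x_def y_def power2_eq_square algebra_simps)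
  \<comment> \<open>The factor \<open>1 - q\<close> completes the square in
    \<open>(1 - q) * x\<close>; the constants \<open>4 * q * (1 - q)\<close> and
    \<open>4 * q\<^sup>2\<close> then add up to \<open>4 * q\<close>.\<close>
  then have "(1 - q) * (x\<^sup>2 + y\<^sup>2) \<le> (1 - q) * (q * ((x + 2)\<^sup>2 + y\<^sup>2))"
    using q by (intro mult_left_mono) auto
  then have "((1 - q) * x - 2 * q)\<^sup>2 + ((1 - q) * y)\<^sup>2 \<le> 4 * q"
    by (simp add: power2_eq_square algebra_simps)
  then have "(norm (of_real (1 - q) * (P z - 1) - of_real (2 * q)))\<^sup>2 \<le> (2 * norm z)\<^sup>2"
    unfolding cmod_power2 Pz by (simp add: q_def power_mult_distrib)
  then show ?thesis unfolding q_def by (rule power2_le_imp_le) simp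
qed

section \<open>Univalence of powers of the derivative of a convex function\<close>

text \<open>Inversion maps the disc of radius 1 about 1 onto the half-plane of real part above 1/2.
  This turns the Ahlfors bound on \<open>Y\<close> into the inward condition of the chain.\<close>

lemma Re_inverse_gt_half:
  fixes Y :: complex
  assumes "norm Y < 1"
  shows "Re (2 / (1 + Y)) > 1"
proof -
  have "(norm Y)\<^sup>2 < 1" using assms by (simp add: abs_square_less_1)
  then have "(Re Y)\<^sup>2 + (Im Y)\<^sup>2 < 1" by (simp add: cmod_power2)
  moreover have "1 + Re Y > 0" using assms abs_Re_le_cmod[of Y] by linarith
  moreover have "(1 + Re Y)\<^sup>2 + (Im Y)\<^sup>2 > 0" using calculation(2) by (simp add: add_pos_nonneg)
  ultimately show ?thesis
    by (simp add: Re_divide pos_less_divide_eq) (simp add: power2_eq_square algebra_simps)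
qed

text \<open>Common to both chains: the Ahlfors chain takes \<open>N = 2\<close> and a complex
  \<open>k\<close>, the close-to-convex chain takes \<open>k = 1\<close> and \<open>N\<close>
  large.\<close>

lemma chain_coefficient:
  fixes k :: complex and N :: nat
  assumes "k \<noteq> 0" "N > 0"
  defines "A \<equiv> \<lambda>r::real. k * of_real (1 / r ^ N - 1)"
  shows "0 < r \<Longrightarrow> (A has_vector_derivative k * of_real (- N / r ^ (N + 1))) (at r)"
    and "filterlim A at_infinity (at_right 0)"
    and "(A \<longlongrightarrow> 0) (at_left 1)"
proof -
  show "(A has_vector_derivative k * of_real (- N / r ^ (N + 1))) (at r)" if "0 < r"
  proof -
    obtain n where n: "N = Suc n" using \<open>N > 0\<close> gr0_conv_Suc by blast
    have "r ^ N \<noteq> 0" using that by simp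
    from DERIV_inverse_fun[OF DERIV_pow this]
    have "((\<lambda>r. inverse (r ^ N)) has_real_derivative - N / r ^ (N + 1)) (at r)"
      using that by (rule_tac DERIV_cong) (auto simp: n field_simps)
    from DERIV_diff[OF this DERIV_const]
    have "((\<lambda>r. 1 / r ^ N - 1) has_real_derivative - N / r ^ (N + 1)) (at r)"
      by (simp add: inverse_eq_divide)
    then show ?thesis unfolding A_def
      by (intro has_vector_derivative_mult_right has_vector_derivative_of_real)
  qed
  have "filterlim (\<lambda>r::real. -1 + inverse r ^ N) at_top (at_right 0)"
    by (intro filterlim_tendsto_add_at_top[OF tendsto_const] filterlim_pow_at_top
        filterlim_inverse_at_top_right \<open>N > 0\<close>)
  then have "filterlim (\<lambda>r::real. 1 / r ^ N - 1) at_top (at_right 0)"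
    by (simp add: field_simps)
  then have "filterlim (\<lambda>r. norm (A r)) at_top (at_right 0)"
    unfolding A_def norm_mult norm_of_real using \<open>k \<noteq> 0\<close>
    by (intro filterlim_tendsto_pos_mult_at_top[OF tendsto_const] filterlim_compose[OF filterlim_abs_real]) auto
  then show "filterlim A at_infinity (at_right 0)" by (rule filterlim_norm_at_top_imp_at_infinity)
  have "(A \<longlongrightarrow> k * of_real (1 / 1 ^ N - 1)) (at_left 1)"
    unfolding A_def by (intro tendsto_intros) auto
  then show "(A \<longlongrightarrow> 0) (at_left 1)" by simp
qed

text \<open>On the circle \<open>norm w = r\<close> the quotient in the inward condition equals
  \<open>2 / (1 + Y w)\<close>, with \<open>Y\<close> the Ahlfors expression. The bound
  \<open>norm (Y w) < 1\<close> follows from \<open>positive_real_part_disc\<close> multiplied by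
  \<open>c / 2\<close>.\<close>

theorem univalent_complex_power:
  assumes hol: "L holomorphic_on ball 0 1"
    and P: "\<And>z. z \<in> ball 0 1 \<Longrightarrow> Re (1 + z * deriv L z) > 0"
    and c: "norm c \<le> 1" "c \<noteq> 1"
    and F: "\<And>z. z \<in> ball 0 1 \<Longrightarrow> (F has_field_derivative exp (c / 2 * L z)) (at z)"
  shows "inj_on F (ball 0 1)"
proof -
  define k where "k = 1 / (1 - c)"
  have "1 - c \<noteq> 0" using c by simp
  then have "k \<noteq> 0" by (simp add: k_def)
  have Rec: "Re (1 - c) \<ge> 0" using c(1) complex_Re_le_cmod[of c] by simp
  define A where "A = (\<lambda>r::real. k * of_real (1 / r\<^sup>2 - 1))"
  define A' where "A' = (\<lambda>r::real. k * of_real (- 2 / r ^ 3))"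
  define H where "H = (\<lambda>w. w * exp (c / 2 * L w))"
  \<comment> \<open>This is w F''/F'.\<close>
  define Q where "Q = (\<lambda>w. c / 2 * (w * deriv L w))"
  have dF: "deriv F w = exp (c / 2 * L w)" if "w \<in> ball 0 1" for w
    using F[OF that] by (rule DERIV_imp_deriv)
  have dH: "deriv H w = exp (c / 2 * L w) * (1 + Q w)" if "w \<in> ball 0 1" for w
    unfolding H_def Q_def
    by (rule DERIV_imp_deriv)
       (auto intro!: derivative_eq_intros holomorphic_derivI[OF hol open_ball that] simp: algebra_simps)
  have hol': "deriv L holomorphic_on ball 0 1" using hol by (intro holomorphic_deriv) auto
  define Y where "Y = (\<lambda>w. of_real (1 - (norm w)\<^sup>2) * Q w - c * of_real ((norm w)\<^sup>2))"
  have Y: "norm (Y w) < 1" if "w \<in> ball 0 1" for w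
  proof -
    have "norm (of_real (1 - (norm w)\<^sup>2) * (1 + w * deriv L w - 1) - of_real (2 * (norm w)\<^sup>2)) \<le> 2 * norm w"
      by (rule positive_real_part_disc[of "\<lambda>w. 1 + w * deriv L w"])
         (use P that in \<open>auto intro!: holomorphic_intros hol'\<close>)
    then have "norm (c / 2) * norm (of_real (1 - (norm w)\<^sup>2) * (1 + w * deriv L w - 1) - of_real (2 * (norm w)\<^sup>2))
        \<le> norm (c / 2) * (2 * norm w)"
      by (intro mult_left_mono) auto
    also have "\<dots> \<le> norm w" using c(1) by (simp add: norm_divide mult_left_le_one_le)
    also have "norm w < 1" using that by simp
    finally show ?thesis
      unfolding norm_mult[symmetric] by (simp add: Y_def Q_def algebra_simps diff_divide_distrib)
  qed
  \<comment> \<open>The two terms of the bracket in \<open>D\<close> below, weighted by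
    \<open>(norm w)\<^sup>2\<close> and its complement. Where \<open>norm w = r\<close>, division by
    \<open>r\<^sup>2\<close> makes this exactly that bracket.\<close>
  have key: "of_real ((norm w)\<^sup>2) * (1 - c) + of_real (1 - (norm w)\<^sup>2) * (1 + Q w) = 1 + Y w" for w
    by (simp add: Y_def algebra_simps)
  have D: "deriv F w + A r * deriv H w = exp (c / 2 * L w) * k * ((1 - c) + of_real (1 / r\<^sup>2 - 1) * (1 + Q w))"
    if "w \<in> ball 0 1" for r w
    unfolding dF[OF that] dH[OF that] A_def k_def using \<open>1 - c \<noteq> 0\<close>
    by (simp add: field_simps del: of_real_diff of_real_divide)
  show ?thesis
  proof (rule inj_on_unit_disk_by_chain[where H = H and A = A and A' = A'])
    show "F holomorphic_on ball 0 1"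
      unfolding holomorphic_on_open[OF open_ball] using F by blast
    show "H holomorphic_on ball 0 1"
      unfolding H_def by (intro holomorphic_intros hol)
    show "deriv F 0 \<noteq> 0" "deriv H 0 \<noteq> 0" by (simp_all add: dF dH Q_def)
    show "(A has_vector_derivative A' r) (at r)" if "0 < r" "r < 1" for r
      unfolding A_def A'_def using chain_coefficient(1)[OF \<open>k \<noteq> 0\<close>, of 2 r] that by (simp add: numeral_3_eq_3)
    show "filterlim A at_infinity (at_right 0)" "(A \<longlongrightarrow> 0) (at_left 1)"
      unfolding A_def by (rule chain_coefficient[OF \<open>k \<noteq> 0\<close>], simp)+
    show "deriv F w + A r * deriv H w \<noteq> 0" if r: "0 < r" "r < 1" "norm w \<le> r" for r w
    proof -
      have w: "w \<in> ball 0 1" using r by simp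
      define a where "a = 1 / r\<^sup>2 - 1"
      define q where "q = (norm w)\<^sup>2"
      have "r\<^sup>2 < 1" using r by (simp add: abs_square_less_1)
      then have "a > 0" using r by (simp add: a_def)
      have "q \<le> r\<^sup>2" unfolding q_def using r by (intro power_mono) auto
      then have s: "1 - q - a * q \<ge> 0" using r by (simp add: a_def field_simps)
      \<comment> \<open>Inside the circle the bracket is compared with its boundary form: up to the
        factor \<open>1 - q\<close> it is a nonnegative multiple of \<open>1 - c\<close>, of real
        part at least 0, plus \<open>a > 0\<close> times \<open>1 + Y w\<close>, of positive real
        part.\<close>
      have "of_real (1 - q) * ((1 - c) + of_real a * (1 + Q w)) =
          of_real (1 - q - a * q) * (1 - c) + of_real a * (of_real q * (1 - c) + of_real (1 - q) * (1 + Q w))"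
        by (simp add: algebra_simps)
      also have "\<dots> = of_real (1 - q - a * q) * (1 - c) + of_real a * (1 + Y w)"
        unfolding q_def key ..
      finally have "Re (of_real (1 - q) * ((1 - c) + of_real a * (1 + Q w))) =
          (1 - q - a * q) * Re (1 - c) + a * Re (1 + Y w)"
        by simp
      moreover have "(1 - q - a * q) * Re (1 - c) \<ge> 0" using s Rec by simp
      moreover have "a * Re (1 + Y w) > 0"
        using \<open>a > 0\<close> Y[OF w] abs_Re_le_cmod[of "Y w"] by (intro mult_pos_pos) auto
      ultimately have "(1 - c) + of_real a * (1 + Q w) \<noteq> 0"
        by (metis add_nonneg_pos less_irrefl mult_zero_right zero_complex.sel(1))
      then show ?thesis unfolding D[OF w] a_def[symmetric] using \<open>1 - c \<noteq> 0\<close> by (simp add: k_def)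
    qed
    show "Re (- of_real r * A' r * H w / (w * (deriv F w + A r * deriv H w))) > 1"
      if r: "0 < r" "r < 1" "norm w = r" for r w
    proof -
      have w: "w \<in> ball 0 1" "w \<noteq> 0" using r by auto
      have 1: "(1 - c) + of_real (1 / r\<^sup>2 - 1) * (1 + Q w) = (1 + Y w) / of_real (r\<^sup>2)"
        using key[of w] r by (simp add: field_simps)
      have 2: "- of_real r * A' r = 2 * k / of_real (r\<^sup>2)"
        using r by (simp add: A'_def power2_eq_square power3_eq_cube)
      have "- of_real r * A' r * H w / (w * (deriv F w + A r * deriv H w)) = 2 / (1 + Y w)"
        unfolding D[OF w(1)] 1 2 unfolding H_def using r w \<open>1 - c \<noteq> 0\<close> by (simp add: k_def)
      then show ?thesis using Re_inverse_gt_half[OF Y[OF w(1)]] by simp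
    qed
  qed
qed

text \<open>Both terms of the derivative of the chain contain the zero-free factor
  \<open>exp L\<close>. What remains is a combination of \<open>e\<close> and \<open>p\<close> with
  nonnegative coefficients, and both have positive real part: \<open>e\<close> because
  \<open>\<bar>t - 1\<bar> \<le> 1 / 2\<close> and \<open>\<bar>Im (L z)\<bar> < pi\<close>.\<close>

theorem univalent_real_power:
  assumes hol: "L holomorphic_on ball 0 1" and L0: "L 0 = 0"
    and P: "\<And>z. z \<in> ball 0 1 \<Longrightarrow> Re (1 + z * deriv L z) > 0"
    and t: "1 / 2 \<le> t" "t \<le> 3 / 2"
    and F: "\<And>z. z \<in> ball 0 1 \<Longrightarrow> (F has_field_derivative exp (of_real t * L z)) (at z)"
  shows "inj_on F (ball 0 1)"
proof -
  define p where "p = (\<lambda>z. 1 + z * deriv L z)"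
  define e where "e = (\<lambda>z. exp (of_real (t - 1) * L z))"
  have hol': "deriv L holomorphic_on ball 0 1" using hol by (intro holomorphic_deriv) auto
  have p_pos: "Re (p z) > 0" if "z \<in> ball 0 1" for z using P[OF that] by (simp add: p_def)
  have e_pos: "Re (e z) > 0" if "z \<in> ball 0 1" for z
  proof -
    have "\<bar>(t - 1) * Im (L z)\<bar> \<le> 1 / 2 * \<bar>Im (L z)\<bar>"
      unfolding abs_mult using t by (intro mult_right_mono abs_leI) auto
    also have "\<dots> < pi / 2" using abs_Im_log_deriv_less_pi[OF hol L0 P that] by simp
    finally have "cos ((t - 1) * Im (L z)) > 0" by (intro cos_gt_zero_pi) linarith+
    then show ?thesis by (simp add: e_def Re_exp)
  qed
  \<comment> \<open>After dilation by \<open>\<rho> < 1\<close> only the values of \<open>p\<close>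
    and \<open>e\<close> on a compact disc matter, which gives a uniform lower bound
    \<open>\<delta>\<close> for the real parts and an upper bound \<open>M\<close> for the
    moduli.\<close>
  have inj: "inj_on (\<lambda>z. F (of_real \<rho> * z)) (ball 0 1)" if \<rho>: "0 < \<rho>" "\<rho> < 1" for \<rho> :: real
  proof -
    have sc: "of_real \<rho> * z \<in> cball 0 \<rho>" if "norm z \<le> 1" for z :: complex
      using that \<rho> by (simp add: norm_mult)
    have sub: "cball 0 \<rho> \<subseteq> ball (0::complex) 1" using \<rho> by auto
    have cont: "continuous_on (cball 0 \<rho>) p" "continuous_on (cball 0 \<rho>) e"
      unfolding p_def e_def
      by (intro continuous_intros holomorphic_on_imp_continuous_on hol[THEN holomorphic_on_subset, OF sub]
           hol'[THEN holomorphic_on_subset, OF sub])+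
    have "compact (cball (0::complex) \<rho>)" "cball (0::complex) \<rho> \<noteq> {}" using \<rho> by auto
    note att = continuous_attains_inf[OF this]
    have contRe: "continuous_on (cball 0 \<rho>) (\<lambda>z. Re (p z))" "continuous_on (cball 0 \<rho>) (\<lambda>z. Re (e z))"
      by (intro continuous_intros cont)+
    obtain a where "a \<in> cball 0 \<rho>" "\<And>z. z \<in> cball 0 \<rho> \<Longrightarrow> Re (p a) \<le> Re (p z)"
      using att[OF contRe(1)] by blast
    moreover obtain b where "b \<in> cball 0 \<rho>" "\<And>z. z \<in> cball 0 \<rho> \<Longrightarrow> Re (e b) \<le> Re (e z)"
      using att[OF contRe(2)] by blast
    ultimately obtain \<delta> where \<delta>: "\<delta> > 0" "\<And>z. z \<in> cball 0 \<rho> \<Longrightarrow> \<delta> \<le> Re (p z)"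
      "\<And>z. z \<in> cball 0 \<rho> \<Longrightarrow> \<delta> \<le> Re (e z)"
      using that[of "min (Re (p a)) (Re (e b))"] p_pos e_pos sub by (metis min.coboundedI1 min.coboundedI2 min_less_iff_conj subsetD)
    have "bounded (p ` cball 0 \<rho> \<union> e ` cball 0 \<rho>)"
      using cont by (intro bounded_Un[THEN iffD2] conjI compact_imp_bounded compact_continuous_image) auto
    then obtain M where M: "M > 0" "\<And>z. z \<in> cball 0 \<rho> \<Longrightarrow> norm (p z) \<le> M"
      "\<And>z. z \<in> cball 0 \<rho> \<Longrightarrow> norm (e z) \<le> M"
      unfolding bounded_pos by auto
    \<comment> \<open>The inward quotient has real part \<open>K * Re d / (norm d)\<^sup>2\<close>,
      which is at least \<open>N * \<delta> / M\<^sup>2\<close>; this choice makes it exceed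
      1.\<close>
    obtain N :: nat where N: "real N > M\<^sup>2 / \<delta>" using reals_Archimedean2 by blast
    then have "N > 0" using M \<delta> by (metis divide_pos_pos gr0I less_asym of_nat_0 zero_less_power)
    define A where "A = (\<lambda>r::real. complex_of_real (1 / r ^ N - 1))"
    define A' where "A' = (\<lambda>r::real. complex_of_real (- N / r ^ (N + 1)))"
    define E where "E = (\<lambda>z. exp (L (of_real \<rho> * z)))"
    define H where "H = (\<lambda>z. z * E z)"
    have inner: "of_real \<rho> * z \<in> ball 0 1" if "norm z \<le> 1" for z :: complex
      using sc[OF that] sub by blast
    have dF: "((\<lambda>z. F (of_real \<rho> * z)) has_field_derivative E w * (of_real \<rho> * e (of_real \<rho> * w))) (at w)"
      if "norm w \<le> 1" for w
    proof -
      have "((\<lambda>z. F (of_real \<rho> * z)) has_field_derivative exp (of_real t * L (of_real \<rho> * w)) * of_real \<rho>) (at w)"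
        by (rule DERIV_chain2[where g = "\<lambda>z. of_real \<rho> * z", OF F[OF inner[OF that]]]) (auto intro!: derivative_eq_intros)
      moreover have "exp (of_real t * L (of_real \<rho> * w)) = E w * e (of_real \<rho> * w)"
        unfolding E_def e_def exp_add[symmetric] by (simp add: algebra_simps)
      ultimately show ?thesis by (simp add: mult_ac)
    qed
    have dH: "(H has_field_derivative E w * p (of_real \<rho> * w)) (at w)" if "norm w \<le> 1" for w
    proof -
      have "((\<lambda>z. L (of_real \<rho> * z)) has_field_derivative deriv L (of_real \<rho> * w) * of_real \<rho>) (at w)"
        by (rule DERIV_chain2[where g = "\<lambda>z. of_real \<rho> * z", OF holomorphic_derivI[OF hol open_ball inner[OF that]]]) (auto intro!: derivative_eq_intros)
      then show ?thesis unfolding H_def E_def p_def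
        by (auto intro!: derivative_eq_intros simp: algebra_simps)
    qed
    define d where "d = (\<lambda>r w. of_real \<rho> * e (of_real \<rho> * w) + A r * p (of_real \<rho> * w))"
    have D: "deriv (\<lambda>z. F (of_real \<rho> * z)) w + A r * deriv H w = E w * d r w" if "norm w \<le> 1" for r w
      unfolding DERIV_imp_deriv[OF dF[OF that]] DERIV_imp_deriv[OF dH[OF that]] d_def
      by (simp add: algebra_simps)
    have Apos: "1 / r ^ N - 1 \<ge> 0" if "0 < r" "r < 1" for r :: real
      using that by (simp add: power_le_one)
    have Re_d: "\<delta> * (\<rho> + (1 / r ^ N - 1)) \<le> Re (d r w)"
      and norm_d: "norm (d r w) \<le> M * (\<rho> + (1 / r ^ N - 1))"
      if r: "0 < r" "r < 1" "norm w \<le> r" for r w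
    proof -
      have w: "of_real \<rho> * w \<in> cball 0 \<rho>" using r by (intro sc) auto
      have "\<rho> * \<delta> + (1 / r ^ N - 1) * \<delta> \<le> \<rho> * Re (e (of_real \<rho> * w)) + (1 / r ^ N - 1) * Re (p (of_real \<rho> * w))"
        using \<rho> Apos[OF r(1,2)] \<delta>(2,3)[OF w] by (intro add_mono mult_left_mono) auto
      also have "\<dots> = Re (d r w)" by (simp add: d_def A_def del: of_real_diff of_real_divide)
      finally show "\<delta> * (\<rho> + (1 / r ^ N - 1)) \<le> Re (d r w)" by (simp add: algebra_simps)
      have "norm (d r w) \<le> \<rho> * norm (e (of_real \<rho> * w)) + (1 / r ^ N - 1) * norm (p (of_real \<rho> * w))"
        unfolding d_def A_def using \<rho> Apos[OF r(1,2)]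
        by (intro order_trans[OF norm_triangle_ineq]) (simp add: norm_mult del: of_real_diff of_real_divide)
      also have "\<dots> \<le> \<rho> * M + (1 / r ^ N - 1) * M"
        using \<rho> Apos[OF r(1,2)] M(2,3)[OF w] by (intro add_mono mult_left_mono) auto
      finally show "norm (d r w) \<le> M * (\<rho> + (1 / r ^ N - 1))" by (simp add: algebra_simps)
    qed
    have Re_d_pos: "Re (d r w) > 0" if "0 < r" "r < 1" "norm w \<le> r" for r w
      using Re_d[OF that] \<delta>(1) \<rho> Apos[OF that(1,2)] by (smt (verit) mult_pos_pos)
    show ?thesis
    proof (rule inj_on_unit_disk_by_chain[where H = H and A = A and A' = A'])
      show "(\<lambda>z. F (of_real \<rho> * z)) holomorphic_on ball 0 1"
        unfolding holomorphic_on_open[OF open_ball] using dF by (meson less_imp_le mem_ball_0)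
      show "H holomorphic_on ball 0 1"
        unfolding holomorphic_on_open[OF open_ball] using dH by (meson less_imp_le mem_ball_0)
      show "deriv (\<lambda>z. F (of_real \<rho> * z)) 0 \<noteq> 0" "deriv H 0 \<noteq> 0"
        using DERIV_imp_deriv[OF dF[of 0]] DERIV_imp_deriv[OF dH[of 0]] \<rho> by (simp_all add: E_def e_def p_def)
      show "(A has_vector_derivative A' r) (at r)" if "0 < r" "r < 1" for r
        unfolding A_def A'_def using chain_coefficient(1)[of 1 N r] that \<open>N > 0\<close> by simp
      show "filterlim A at_infinity (at_right 0)" "(A \<longlongrightarrow> 0) (at_left 1)"
        unfolding A_def using chain_coefficient(2,3)[of 1 N] \<open>N > 0\<close> by simp_all
      show "deriv (\<lambda>z. F (of_real \<rho> * z)) w + A r * deriv H w \<noteq> 0"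
        if "0 < r" "r < 1" "norm w \<le> r" for r w
        using Re_d_pos[OF that] D[of w r] that by (auto simp: E_def)
      show "Re (- of_real r * A' r * H w / (w * (deriv (\<lambda>z. F (of_real \<rho> * z)) w + A r * deriv H w))) > 1"
        if r: "0 < r" "r < 1" "norm w = r" for r w
      proof -
        have "w \<noteq> 0" "norm w \<le> 1" "norm w \<le> r" using r by auto
        define K where "K = N / r ^ N"
        have rA: "- of_real r * A' r = of_real K"
          using r by (simp add: A'_def K_def)
        have "- of_real r * A' r * H w / (w * (deriv (\<lambda>z. F (of_real \<rho> * z)) w + A r * deriv H w)) = of_real K / d r w"
          unfolding D[OF \<open>norm w \<le> 1\<close>] rA unfolding H_def using \<open>w \<noteq> 0\<close> by (simp add: E_def)
        moreover have "Re (of_real K / d r w) > 1"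
        proof -
          \<comment> \<open>\<open>x\<close> is the common scale in \<open>Re_d\<close> and
            \<open>norm_d\<close>. It is at most \<open>1 / r ^ N\<close> since
            \<open>\<rho> < 1\<close>, so \<open>K\<close> dominates \<open>N * x\<close> and the
            powers of \<open>x\<close> cancel.\<close>
          define x where "x = \<rho> + (1 / r ^ N - 1)"
          have x: "0 < x" "x \<le> 1 / r ^ N" using \<rho> Apos[OF r(1,2)] by (auto simp: x_def)
          have "(norm (d r w))\<^sup>2 \<le> (M * x)\<^sup>2"
            using norm_d[OF r(1,2) \<open>norm w \<le> r\<close>] by (intro power_mono) (auto simp: x_def)
          also have "\<dots> = M\<^sup>2 * x * x" by (simp add: power2_eq_square)
          also have "\<dots> < (N * \<delta>) * x * x"
            using N \<delta>(1) x by (intro mult_strict_right_mono) (auto simp: field_simps)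
          also have "\<dots> = (N * x) * (\<delta> * x)" by simp
          also have "\<dots> \<le> K * Re (d r w)"
          proof (rule mult_mono)
            show "N * x \<le> K" using mult_left_mono[OF x(2), of "real N"] by (simp add: K_def)
            show "\<delta> * x \<le> Re (d r w)" using Re_d[OF r(1,2) \<open>norm w \<le> r\<close>] by (simp add: x_def)
          qed (use x \<delta>(1) r in \<open>auto simp: K_def\<close>)
          finally have "(norm (d r w))\<^sup>2 < K * Re (d r w)" .
          moreover have "(norm (d r w))\<^sup>2 > 0" using Re_d_pos[OF r(1,2) \<open>norm w \<le> r\<close>] by auto
          moreover have "Re (of_real K / d r w) = K * Re (d r w) / (norm (d r w))\<^sup>2"
            by (simp add: Re_divide cmod_power2)
          ultimately show ?thesis by (simp only: pos_less_divide_eq mult_1)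
        qed
        ultimately show ?thesis by simp
      qed
    qed
  qed
  show ?thesis
  proof (rule inj_onI)
    fix z1 z2 assume z: "z1 \<in> ball 0 1" "z2 \<in> ball 0 1" "F z1 = F z2"
    define m where "m = max (norm z1) (norm z2)"
    have m: "m < 1" "0 \<le> m" "norm z1 \<le> m" "norm z2 \<le> m" using z by (auto simp: m_def le_max_iff_disj)
    define \<rho> where "\<rho> = (m + 1) / 2"
    have \<rho>: "m < \<rho>" "\<rho> < 1" "0 < \<rho>" using m by (auto simp: \<rho>_def)
    have "z1 / of_real \<rho> = z2 / of_real \<rho>"
      by (rule inj_onD[OF inj[OF \<rho>(3,2)]]) (use z m \<rho> in \<open>auto simp: norm_divide\<close>)
    then show "z1 = z2" using \<rho> by simp
  qed
qed

section \<open>The Hornich operation on K(lam)\<close>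

lemma log_deriv_branch_exists:
  assumes "classA f" "\<forall>z\<in>unit_disk. deriv f z \<noteq> 0"
  shows "\<exists>L. L holomorphic_on unit_disk \<and> L 0 = 0 \<and> (\<forall>z\<in>unit_disk. exp (L z) = deriv f z)"
proof -
  have "deriv f holomorphic_on unit_disk"
    using assms(1) by (auto simp: classA_def intro: holomorphic_deriv)
  then obtain g where g: "g holomorphic_on unit_disk" "\<And>z. z \<in> unit_disk \<Longrightarrow> exp (g z) = deriv f z"
    using holomorphic_logarithm_exists[of unit_disk "deriv f" 0] assms(2) by auto
  have "exp (g 0) = 1" using g(2)[of 0] assms(1) by (simp add: classA_def)
  then show ?thesis
    using g by (intro exI[of _ "\<lambda>z. g z - g 0"]) (auto simp: exp_diff intro!: holomorphic_intros)
qed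

lemma log_deriv_branch:
  assumes "classA f" "\<forall>z\<in>unit_disk. deriv f z \<noteq> 0"
  shows "log_deriv_branch f holomorphic_on unit_disk" "log_deriv_branch f 0 = 0"
    and "z \<in> unit_disk \<Longrightarrow> exp (log_deriv_branch f z) = deriv f z"
    and "z \<in> unit_disk \<Longrightarrow> deriv (log_deriv_branch f) z = deriv (deriv f) z / deriv f z"
proof -
  let ?L = "log_deriv_branch f"
  from someI_ex[OF log_deriv_branch_exists[OF assms]]
  have L: "?L holomorphic_on unit_disk" "?L 0 = 0" "\<And>z. z \<in> unit_disk \<Longrightarrow> exp (?L z) = deriv f z"
    by (auto simp: log_deriv_branch_def)
  then show "?L holomorphic_on unit_disk" "?L 0 = 0" "z \<in> unit_disk \<Longrightarrow> exp (?L z) = deriv f z"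
    by auto
  show "deriv ?L z = deriv (deriv f) z / deriv f z" if z: "z \<in> unit_disk"
  proof -
    have "((\<lambda>z. exp (?L z)) has_field_derivative exp (?L z) * deriv ?L z) (at z)"
      by (rule DERIV_chain2[OF DERIV_exp holomorphic_derivI[OF L(1) open_ball z]])
    then have "(deriv f has_field_derivative exp (?L z) * deriv ?L z) (at z)"
      by (rule has_field_derivative_transform_within_open[OF _ open_ball z L(3)])
    then have "deriv (deriv f) z = deriv f z * deriv ?L z"
      using L(3)[OF z] by (simp add: DERIV_imp_deriv)
    then show ?thesis using assms(2) z by simp
  qed
qed

lemma hornich_has_field_derivative:
  assumes "classA f" "\<forall>z\<in>unit_disk. deriv f z \<noteq> 0" and z: "z \<in> unit_disk"
  shows "(hornich \<gamma> f has_field_derivative exp (\<gamma> * log_deriv_branch f z)) (at z)"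
proof -
  let ?h = "\<lambda>w. exp (\<gamma> * log_deriv_branch f w)"
  have "?h holomorphic_on unit_disk"
    by (intro holomorphic_intros log_deriv_branch(1) assms(1,2))
  then obtain g where g: "\<And>w. w \<in> unit_disk \<Longrightarrow> (g has_field_derivative ?h w) (at w within unit_disk)"
    using holomorphic_convex_primitive'[OF convex_ball open_ball] by blast
  have eq: "g w - g 0 = hornich \<gamma> f w" if w: "w \<in> unit_disk" for w
  proof -
    have "path_image (linepath 0 w) \<subseteq> unit_disk"
      using w by (simp add: closed_segment_subset)
    from contour_integral_primitive[OF g valid_path_linepath this]
    have "(?h has_contour_integral g w - g 0) (linepath 0 w)" by simp
    then show ?thesis by (simp add: hornich_def contour_integral_unique)
  qed
  have "((\<lambda>w. g w - g 0) has_field_derivative ?h z) (at z)"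
    using g[OF z] z by (auto intro!: derivative_eq_intros simp: at_within_open[OF z open_ball])
  then show ?thesis
    by (rule has_field_derivative_transform_within_open[OF _ open_ball z eq])
qed

lemma classS_hornich_iff:
  assumes "classA f" "\<forall>z\<in>unit_disk. deriv f z \<noteq> 0"
  shows "classS (hornich \<gamma> f) \<longleftrightarrow> inj_on (hornich \<gamma> f) unit_disk"
proof -
  have "hornich \<gamma> f holomorphic_on unit_disk"
    unfolding holomorphic_on_open[OF open_ball]
    using hornich_has_field_derivative[OF assms] by blast
  moreover have "deriv (hornich \<gamma> f) 0 = 1"
    using DERIV_imp_deriv[OF hornich_has_field_derivative[OF assms, of 0]] log_deriv_branch(2)[OF assms] by simp
  moreover have "hornich \<gamma> f 0 = 0" by (simp add: hornich_def)
  ultimately show ?thesis by (simp add: classS_def classA_def)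
qed

text \<open>Dividing log f' by \<open>1 - lam\<close> turns the condition of order
  \<open>lam\<close> into \<open>Re (1 + z * deriv L z) > 0\<close>, and the exponent becomes
  \<open>\<gamma> * (1 - lam) * L\<close>.\<close>

lemma hornich_univalent:
  assumes "lam < 1" "classK lam f"
    and \<gamma>: "norm \<gamma> \<le> 1 / (2 * (1 - lam)) \<or>
            \<gamma> \<in> complex_of_real ` {1 / (2 * (1 - lam)) .. 3 / (2 * (1 - lam))}"
  shows "classS (hornich \<gamma> f)"
proof -
  define m where "m = 1 - lam"
  have "m > 0" using assms by (simp add: m_def)
  have f: "classA f" "\<forall>z\<in>unit_disk. deriv f z \<noteq> 0"
    and K: "\<And>z. z \<in> unit_disk \<Longrightarrow> Re (1 + z * deriv (deriv f) z / deriv f z) > lam"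
    using assms(2) by (auto simp: classK_def)
  define L where "L = (\<lambda>z. log_deriv_branch f z / of_real m)"
  note B = log_deriv_branch[OF f]
  have hol: "L holomorphic_on ball 0 1"
    unfolding L_def using \<open>m > 0\<close> by (intro holomorphic_intros B(1)) auto
  have L0: "L 0 = 0" using B(2) by (simp add: L_def)
  have P: "Re (1 + z * deriv L z) > 0" if z: "z \<in> ball 0 1" for z
  proof -
    have "(L has_field_derivative deriv (log_deriv_branch f) z / of_real m) (at z)"
      unfolding L_def by (intro DERIV_cdivide holomorphic_derivI[OF B(1) open_ball z])
    then have "z * deriv L z = (z * deriv (deriv f) z / deriv f z) / of_real m"
      using B(4)[OF z] by (simp add: DERIV_imp_deriv)
    then have "Re (1 + z * deriv L z) = 1 + Re (z * deriv (deriv f) z / deriv f z) / m"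
      by (simp only: plus_complex.sel one_complex.sel Re_divide_of_real)
    moreover have "Re (z * deriv (deriv f) z / deriv f z) > - m"
      using K[OF z] unfolding m_def plus_complex.sel one_complex.sel by linarith
    then have "Re (z * deriv (deriv f) z / deriv f z) / m > - 1"
      using \<open>m > 0\<close> by (simp add: pos_less_divide_eq)
    ultimately show ?thesis by linarith
  qed
  have D: "(hornich \<gamma> f has_field_derivative exp (\<gamma> * of_real m * L z)) (at z)" if "z \<in> ball 0 1" for z
    using hornich_has_field_derivative[OF f that] \<open>m > 0\<close> by (simp add: L_def)
  have "inj_on (hornich \<gamma> f) unit_disk"
  \<comment> \<open>The segment is treated first: it contains the boundary point
    \<open>1 / (2 * m)\<close>, which corresponds to the value \<open>c = 1\<close> excluded from
    \<open>univalent_complex_power\<close>.\<close>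
  proof (cases "\<gamma> \<in> complex_of_real ` {1 / (2 * m) .. 3 / (2 * m)}")
    case True
    then obtain x where x: "\<gamma> = of_real x" "1 / (2 * m) \<le> x" "x \<le> 3 / (2 * m)" by auto
    show ?thesis
    proof (rule univalent_real_power[OF hol L0 P])
      show "1 / 2 \<le> x * m" "x * m \<le> 3 / 2" using x \<open>m > 0\<close> by (auto simp: field_simps)
      show "(hornich \<gamma> f has_field_derivative exp (of_real (x * m) * L z)) (at z)" if "z \<in> ball 0 1" for z
        using D[OF that] by (simp add: x)
    qed
  next
    case False
    show ?thesis
    proof (rule univalent_complex_power[OF hol P])
      have "norm \<gamma> \<le> 1 / (2 * m)" using \<gamma> False by (simp add: m_def)
      then show "norm (2 * \<gamma> * of_real m) \<le> 1" using \<open>m > 0\<close> by (simp add: norm_mult field_simps)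
      show "2 * \<gamma> * of_real m \<noteq> 1"
      proof
        assume "2 * \<gamma> * of_real m = 1"
        then have "\<gamma> = of_real (1 / (2 * m))" using \<open>m > 0\<close> by (simp add: field_simps)
        moreover have "1 / (2 * m) \<in> {1 / (2 * m) .. 3 / (2 * m)}"
          using \<open>m > 0\<close> by (simp add: field_simps)
        ultimately show False using False by blast
      qed
      show "(hornich \<gamma> f has_field_derivative exp (2 * \<gamma> * of_real m / 2 * L z)) (at z)" if "z \<in> ball 0 1" for z
        using D[OF that] by simp
    qed
  qed
  then show ?thesis using classS_hornich_iff[OF f] by blast
qed

section \<open>Sharpness: powers of 1 - z outside the region\<close>

text \<open>Together the hypotheses say \<open>\<bar>2 * Re (1 / a)\<bar> < 1\<close>, which means
  that the period 2 pi i / a of \<open>exp (a * u)\<close> has imaginary part below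
  \<open>pi\<close> in modulus.\<close>

lemma power_not_injective:
  fixes a :: complex
  assumes "norm (a - 1) > 1" "norm (a + 1) > 1"
  shows "\<not> inj_on (\<lambda>z. exp (a * Ln (1 - z))) (ball 0 1)"
proof
  assume inj: "inj_on (\<lambda>z. exp (a * Ln (1 - z))) (ball 0 1)"
  have "a \<noteq> 0" using assms by auto
  then have na: "(norm a)\<^sup>2 > 0" by simp
  have "(norm (a - 1))\<^sup>2 > 1" "(norm (a + 1))\<^sup>2 > 1" using assms by (simp_all add: one_less_power)
  then have "2 * Re a < (norm a)\<^sup>2" "- 2 * Re a < (norm a)\<^sup>2"
    unfolding cmod_power2 by (simp_all add: power2_eq_square algebra_simps)
  then have "\<bar>2 * Re a / (norm a)\<^sup>2\<bar> < 1" using na by (simp add: abs_less_iff field_simps)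
  moreover have "2 * Re (1 / a) = 2 * Re a / (norm a)\<^sup>2" by (simp add: Re_divide cmod_power2)
  ultimately have Rea: "\<bar>2 * Re (1 / a)\<bar> < 1" by simp
  \<comment> \<open>A shift by v does not change exp(a u), and since |Im v| < pi two points of the convex region
    {Ln (1 - z)}, unbounded to the left, differ by v.\<close>
  define v where "v = 2 * of_real pi * \<i> / a"
  have "v \<noteq> 0" using \<open>a \<noteq> 0\<close> by (simp add: v_def)
  have Imv: "Im v = pi * (2 * Re (1 / a))"
  proof -
    have "v = of_real (2 * pi) * (\<i> * (1 / a))" by (simp add: v_def)
    then have "Im v = 2 * pi * Im (\<i> * (1 / a))" by (metis Im_complex_of_real Re_complex_of_real add.right_neutral mult_zero_left times_complex.simps(2))
    then show ?thesis by (simp add: Re_divide Im_divide)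
  qed
  have "\<bar>Im v\<bar> < pi" unfolding Imv abs_mult using Rea by simp
  define C where "C = cos (Im v / 2)"
  have "C > 0" unfolding C_def using \<open>\<bar>Im v\<bar> < pi\<close> by (intro cos_gt_zero_pi) auto
  \<comment> \<open>\<open>1 - exp p\<close> lies in the unit disc exactly when
    \<open>exp (Re p) < 2 * cos (Im p)\<close>. Here \<open>cos (Im p) = C\<close> for both points,
    and the shift by \<open>X\<close> makes \<open>Re p \<le> ln C\<close> for either sign of
    \<open>Re v\<close>.\<close>
  define X where "X = \<bar>Re v\<bar> / 2 - ln C"
  have disc: "1 - exp p \<in> ball 0 1" "Ln (exp p) = p"
    if p: "p = of_real (- X) + v / 2 \<or> p = of_real (- X) - v / 2" for p
  proof -
    have Imp: "Im p = Im v / 2 \<or> Im p = - (Im v / 2)" using p by auto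
    then have "cos (Im p) = C" unfolding C_def by (metis cos_minus)
    have "Re p \<le> ln C" using p by (auto simp: X_def)
    then have "exp (Re p) \<le> C" using \<open>C > 0\<close> by (metis exp_le_cancel_iff exp_ln)
    then have "exp (Re p) < 2 * C" using \<open>C > 0\<close> by simp
    then have "exp (Re p) * exp (Re p) < exp (Re p) * (2 * C)" by (intro mult_strict_left_mono) auto
    moreover have "(norm (1 - exp p))\<^sup>2 = 1 - 2 * (exp (Re p) * C) + exp (Re p) * exp (Re p)"
    proof -
      have "(norm (1 - exp p))\<^sup>2 = 1 - 2 * (exp (Re p) * cos (Im p)) + (exp (Re p))\<^sup>2 * ((cos (Im p))\<^sup>2 + (sin (Im p))\<^sup>2)"
        unfolding cmod_power2
        by (simp add: Re_exp Im_exp power2_eq_square algebra_simps del: sin_cos_squared_add sin_cos_squared_add2 sin_cos_squared_add3)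
      also have "\<dots> = 1 - 2 * (exp (Re p) * C) + (exp (Re p))\<^sup>2"
        unfolding sin_cos_squared_add2 using \<open>cos (Im p) = C\<close> by simp
      finally show ?thesis by (simp only: power2_eq_square)
    qed
    ultimately have "(norm (1 - exp p))\<^sup>2 < 1\<^sup>2" by simp
    then have "norm (1 - exp p) < 1" by (rule power2_less_imp_less) simp
    then show "1 - exp p \<in> ball 0 1" by simp
    show "Ln (exp p) = p" using Imp \<open>\<bar>Im v\<bar> < pi\<close> by (intro Ln_exp) auto
  qed
  define p q where "p = of_real (- X) + v / 2" and "q = of_real (- X) - v / 2"
  have p: "1 - exp p \<in> ball 0 1" "Ln (exp p) = p" and q: "1 - exp q \<in> ball 0 1" "Ln (exp q) = q"
    using disc[of p] disc[of q] by (simp_all add: p_def q_def)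
  have "a * p = a * q + a * v" by (simp add: p_def q_def algebra_simps)
  also have "a * v = 2 * of_real pi * \<i>" using \<open>a \<noteq> 0\<close> by (simp add: v_def)
  finally have "exp (a * p) = exp (a * q)" by (simp add: exp_add)
  then have "exp (a * Ln (1 - (1 - exp p))) = exp (a * Ln (1 - (1 - exp q)))"
    using p(2) q(2) by simp
  then have "1 - exp p = 1 - exp q" by (rule inj_onD[OF inj _ p(1) q(1)])
  then have "Ln (exp p) = Ln (exp q)" by simp
  then have "p = q" using p(2) q(2) by simp
  then show False using \<open>v \<noteq> 0\<close> by (simp add: p_def q_def)
qed

text \<open>The closed unit discs about 0 and 2 touch only at 1. A ray from 0 other than the
  positive axis thus leaves the first disc outside the second, and the point just beyond the exit
  works. If \<open>c\<close> is positive it exceeds 3 and \<open>\<mu> = 1\<close> works.\<close>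

lemma shrink_outside_discs:
  fixes c :: complex
  assumes "norm c > 1" "c \<notin> complex_of_real ` {1..3}"
  obtains \<mu> where "0 < \<mu>" "\<mu> \<le> 1" "norm (of_real \<mu> * c) > 1" "norm (of_real \<mu> * c - 2) > 1"
proof (cases "c = of_real (norm c)")
  case True
  define s where "s = norm c"
  have c: "c = of_real s" using True by (simp add: s_def)
  have "s > 3"
  proof (rule ccontr)
    assume "\<not> s > 3"
    then have "s \<in> {1..3}" using assms(1) by (simp add: s_def)
    then show False using assms(2) c by blast
  qed
  then have "norm (complex_of_real (s - 2)) > 1" unfolding norm_of_real by simp
  then have "norm (c - 2) > 1" by (simp add: c)
  then show ?thesis using that[of 1] assms(1) by simp
next
  case False
  define s where "s = norm c"
  have "s > 1" using assms by (simp add: s_def)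
  define \<rho> where "\<rho> = Re c / s"
  have "Re c < s"
  proof (rule ccontr)
    assume "\<not> Re c < s"
    then have "Re c = norm c" using complex_Re_le_cmod[of c] by (simp add: s_def)
    then have "Im c = 0" using cmod_power2[of c] by simp
    with \<open>Re c = norm c\<close> False show False by (simp add: complex_eq_iff)
  qed
  then have "\<rho> < 1" using \<open>s > 1\<close> by (simp add: \<rho>_def)
  \<comment> \<open>The bound \<open>s - 1\<close> keeps \<open>\<mu> \<le> 1\<close>. The bound
    \<open>1 - \<rho>\<close>, with \<open>\<rho>\<close> the cosine of the argument of
    \<open>c\<close>, makes \<open>4 * (1 - \<rho>)\<close> outweigh \<open>2 * \<epsilon>\<close>
    in the squared distance to 2.\<close>
  define \<epsilon> where "\<epsilon> = min (1 - \<rho>) (s - 1)"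
  have \<epsilon>: "0 < \<epsilon>" "\<epsilon> \<le> 1 - \<rho>" "1 + \<epsilon> \<le> s" using \<open>\<rho> < 1\<close> \<open>s > 1\<close> by (auto simp: \<epsilon>_def)
  define \<mu> where "\<mu> = (1 + \<epsilon>) / s"
  have \<mu>: "0 < \<mu>" "\<mu> \<le> 1" using \<epsilon> \<open>s > 1\<close> by (auto simp: \<mu>_def)
  have n: "norm (of_real \<mu> * c) = 1 + \<epsilon>"
  proof -
    have "norm (of_real \<mu> * c) = \<mu> * s" using \<mu> by (simp add: norm_mult s_def)
    then show ?thesis using \<open>s > 1\<close> by (simp add: \<mu>_def)
  qed
  have re: "Re (of_real \<mu> * c) = (1 + \<epsilon>) * \<rho>" by (simp add: \<mu>_def \<rho>_def)
  have "(norm (of_real \<mu> * c - 2))\<^sup>2 = (norm (of_real \<mu> * c))\<^sup>2 - 4 * Re (of_real \<mu> * c) + 4"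
    unfolding cmod_power2 by (simp add: power2_eq_square algebra_simps)
  also have "\<dots> = 1 + (4 * (1 - \<rho>) - 2 * \<epsilon>) + 4 * \<epsilon> * (1 - \<rho>) + \<epsilon>\<^sup>2"
    unfolding n re by (simp add: power2_eq_square algebra_simps)
  also have "\<dots> > 1"
  proof -
    have "4 * (1 - \<rho>) - 2 * \<epsilon> > 0" using \<epsilon>(2) \<open>\<rho> < 1\<close> by auto
    moreover have "4 * \<epsilon> * (1 - \<rho>) > 0" using \<epsilon> \<open>\<rho> < 1\<close> by simp
    ultimately show ?thesis using zero_le_power2[of \<epsilon>] by linarith
  qed
  finally have "(norm (of_real \<mu> * c - 2))\<^sup>2 > 1\<^sup>2" by simp
  then have "norm (of_real \<mu> * c - 2) > 1" by (rule power2_less_imp_less) simp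
  then show ?thesis using that[OF \<mu>] n \<epsilon> by simp
qed

text \<open>For \<open>b = 2 * (1 - lam) * \<mu>\<close> and f' = (1 - z)^(-b), z f''/f' is
  \<open>b * z / (1 - z)\<close>. As \<open>z / (1 - z)\<close> has real part above -1/2 on the
  disc, the convexity expression exceeds \<open>1 - (1 - lam) * \<mu> \<ge> lam\<close>.\<close>

lemma classK_power_example:
  assumes "lam < 1" "0 < \<mu>" "\<mu> \<le> 1"
  shows "\<exists>f. classK lam f \<and>
    (\<forall>z\<in>unit_disk. log_deriv_branch f z = - of_real (2 * (1 - lam) * \<mu>) * Ln (1 - z))"
proof -
  define b where "b = 2 * (1 - lam) * \<mu>"
  define L where "L = (\<lambda>z. - of_real b * Ln (1 - z))"
  have slit: "1 - z \<notin> \<real>\<^sub>\<le>\<^sub>0" and nz: "1 - z \<noteq> 0" if "z \<in> unit_disk" for z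
  proof -
    have "Re (1 - z) > 0" using that complex_Re_le_cmod[of z] by simp
    then show "1 - z \<notin> \<real>\<^sub>\<le>\<^sub>0" "1 - z \<noteq> 0" by (auto simp: complex_nonpos_Reals_iff)
  qed
  have dL: "(L has_field_derivative of_real b / (1 - z)) (at z)" if "z \<in> unit_disk" for z
    unfolding L_def using slit[OF that] nz[OF that] by (auto intro!: derivative_eq_intros simp: field_simps)
  then have holL: "L holomorphic_on unit_disk"
    unfolding holomorphic_on_open[OF open_ball] by blast
  have L0: "L 0 = 0" by (simp add: L_def)
  have "(\<lambda>z. exp (L z)) holomorphic_on unit_disk" by (intro holomorphic_intros holL)
  then obtain g where g: "\<And>w. w \<in> unit_disk \<Longrightarrow> (g has_field_derivative exp (L w)) (at w within unit_disk)"
    using holomorphic_convex_primitive'[OF convex_ball open_ball] by blast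
  define f where "f = (\<lambda>z. g z - g 0)"
  have f: "(f has_field_derivative exp (L z)) (at z)" if "z \<in> unit_disk" for z
    unfolding f_def using g[OF that] that
    by (auto intro!: derivative_eq_intros simp: at_within_open[OF that open_ball])
  have df: "deriv f z = exp (L z)" if "z \<in> unit_disk" for z
    using f[OF that] by (rule DERIV_imp_deriv)
  have ddf: "deriv (deriv f) z = exp (L z) * (of_real b / (1 - z))" if z: "z \<in> unit_disk" for z
  proof (rule DERIV_imp_deriv)
    have "((\<lambda>z. exp (L z)) has_field_derivative exp (L z) * (of_real b / (1 - z))) (at z)"
      by (rule DERIV_chain2[OF DERIV_exp dL[OF z]])
    then show "(deriv f has_field_derivative exp (L z) * (of_real b / (1 - z))) (at z)"
      by (rule has_field_derivative_transform_within_open[OF _ open_ball z]) (simp add: df)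
  qed
  have A: "classA f"
  proof -
    have "f holomorphic_on unit_disk" unfolding holomorphic_on_open[OF open_ball] using f by blast
    moreover have "f 0 = 0" by (simp add: f_def)
    ultimately show ?thesis using df[of 0] L0 by (simp add: classA_def)
  qed
  have nz': "\<forall>z\<in>unit_disk. deriv f z \<noteq> 0" using df by simp
  have "Re (1 + z * deriv (deriv f) z / deriv f z) > lam" if z: "z \<in> unit_disk" for z
  proof -
    have "1 + z * deriv (deriv f) z / deriv f z = 1 + of_real b * (z / (1 - z))"
      by (simp add: df[OF z] ddf[OF z])
    then have "Re (1 + z * deriv (deriv f) z / deriv f z) = 1 + b * Re (z / (1 - z))"
      by (metis (no_types) Im_complex_of_real Re_complex_of_real diff_zero mult_zero_left one_complex.sel(1) plus_complex.sel(1) times_complex.sel(1))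
    moreover have "Re (z / (1 - z)) > - 1 / 2"
    proof -
      have "(norm z)\<^sup>2 < 1" using z by (simp add: abs_square_less_1)
      then have zz: "Re z * Re z + Im z * Im z < 1" unfolding cmod_power2 by (simp add: power2_eq_square)
      have "(norm (1 - z))\<^sup>2 > 0" using nz[OF z] by simp
      then have "(1 - Re z)\<^sup>2 + (Im z)\<^sup>2 > 0" unfolding cmod_power2 by simp
      then show ?thesis using zz
        by (simp add: Re_divide pos_less_divide_eq) (simp add: power2_eq_square field_simps)
    qed
    then have "b * (- 1 / 2) < b * Re (z / (1 - z))"
      using assms by (intro mult_strict_left_mono) (auto simp: b_def)
    moreover have "(1 - lam) * \<mu> \<le> 1 - lam" using assms by (simp add: mult_left_le)
    moreover have "b * (- 1 / 2) = - ((1 - lam) * \<mu>)" by (simp add: b_def)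
    ultimately show ?thesis by linarith
  qed
  then have "classK lam f" using A nz' by (auto simp: classK_def)
  \<comment> \<open>The branch given by choice is pinned down: both logarithms have derivative
    f''/f' and vanish at 0.\<close>
  moreover have "log_deriv_branch f z = L z" if z: "z \<in> unit_disk" for z
  proof -
    note B = log_deriv_branch[OF A nz']
    have "\<exists>c. \<forall>w\<in>unit_disk. log_deriv_branch f w - L w = c"
    proof (rule has_field_derivative_zero_constant[OF convex_ball])
      fix w assume w: "w \<in> unit_disk"
      have "((\<lambda>w. log_deriv_branch f w - L w) has_field_derivative
          deriv (log_deriv_branch f) w - of_real b / (1 - w)) (at w)"
        by (intro DERIV_diff dL[OF w] holomorphic_derivI[OF B(1) open_ball w])
      moreover have "deriv (log_deriv_branch f) w = of_real b / (1 - w)"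
        using B(4)[OF w] by (simp add: df[OF w] ddf[OF w])
      ultimately show "((\<lambda>w. log_deriv_branch f w - L w) has_field_derivative 0) (at w within unit_disk)"
        by (simp add: has_field_derivative_at_within)
    qed
    then obtain c where c: "\<And>w. w \<in> unit_disk \<Longrightarrow> log_deriv_branch f w - L w = c" by blast
    have "c = 0" using c[of 0] B(2) L0 by simp
    then show ?thesis using c[OF z] by simp
  qed
  ultimately show ?thesis unfolding L_def b_def by blast
qed

lemma hornich_not_univalent:
  assumes "lam < 1" and big: "norm \<gamma> > 1 / (2 * (1 - lam))"
    and out: "\<gamma> \<notin> complex_of_real ` {1 / (2 * (1 - lam)) .. 3 / (2 * (1 - lam))}"
  obtains f where "classK lam f" "\<not> classS (hornich \<gamma> f)"
proof -
  define m where "m = 1 - lam"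
  have "m > 0" using assms by (simp add: m_def)
  define c where "c = of_real (2 * m) * \<gamma>"
  have "norm c = 2 * m * norm \<gamma>" using \<open>m > 0\<close> by (simp add: c_def norm_mult)
  then have "norm c > 1" using big \<open>m > 0\<close> unfolding m_def[symmetric] by (simp add: field_simps)
  moreover have "c \<notin> complex_of_real ` {1..3}"
  proof
    assume "c \<in> complex_of_real ` {1..3}"
    then obtain x where x: "c = of_real x" "1 \<le> x" "x \<le> 3" by auto
    then have "\<gamma> = complex_of_real (x / (2 * m))" using \<open>m > 0\<close> by (simp add: c_def field_simps)
    moreover have "x / (2 * m) \<in> {1 / (2 * m) .. 3 / (2 * m)}"
      using x \<open>m > 0\<close> by (simp add: divide_right_mono)
    ultimately show False using out unfolding m_def[symmetric] by blast
  qed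
  ultimately obtain \<mu> where \<mu>: "0 < \<mu>" "\<mu> \<le> 1" "norm (of_real \<mu> * c) > 1" "norm (of_real \<mu> * c - 2) > 1"
    by (rule shrink_outside_discs)
  obtain f where f: "classK lam f"
    and B: "\<And>z. z \<in> unit_disk \<Longrightarrow> log_deriv_branch f z = - of_real (2 * (1 - lam) * \<mu>) * Ln (1 - z)"
    using classK_power_example[OF \<open>lam < 1\<close> \<mu>(1,2)] by blast
  have f': "classA f" "\<forall>z\<in>unit_disk. deriv f z \<noteq> 0" using f by (auto simp: classK_def)
  define a where "a = 1 - of_real \<mu> * c"
  have "a \<noteq> 0" using \<mu>(3) by (auto simp: a_def)
  \<comment> \<open>The transform is an affine image of (1 - z)^a with \<open>a \<noteq> 0\<close>,
    so the two are injective together. The distances of \<open>a\<close> from 1 and -1 are those of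
    \<open>of_real \<mu> * c\<close> from 0 and 2.\<close>
  have "\<exists>k. \<forall>z\<in>unit_disk. a * hornich \<gamma> f z + exp (a * Ln (1 - z)) = k"
  proof (rule has_field_derivative_zero_constant[OF convex_ball])
    fix z assume z: "z \<in> unit_disk"
    have "Re (1 - z) > 0" using z complex_Re_le_cmod[of z] by simp
    then have slit: "1 - z \<notin> \<real>\<^sub>\<le>\<^sub>0" "1 - z \<noteq> 0" by (auto simp: complex_nonpos_Reals_iff)
    have "((\<lambda>z. Ln (1 - z)) has_field_derivative - 1 / (1 - z)) (at z)"
      using slit by (auto intro!: derivative_eq_intros simp: field_simps)
    then have "((\<lambda>z. exp (a * Ln (1 - z))) has_field_derivative exp (a * Ln (1 - z)) * (a * (- 1 / (1 - z)))) (at z)"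
      by (intro DERIV_chain2[OF DERIV_exp] DERIV_cmult)
    moreover have "exp (a * Ln (1 - z)) = exp (\<gamma> * log_deriv_branch f z) * (1 - z)"
    proof -
      have "a * Ln (1 - z) = \<gamma> * log_deriv_branch f z + Ln (1 - z)"
        unfolding B[OF z] by (simp add: a_def c_def m_def algebra_simps)
      then show ?thesis using slit by (simp add: exp_add)
    qed
    ultimately have "((\<lambda>z. exp (a * Ln (1 - z))) has_field_derivative - (a * exp (\<gamma> * log_deriv_branch f z))) (at z)"
      using slit by (simp add: mult.commute)
    from DERIV_add[OF DERIV_cmult[OF hornich_has_field_derivative[OF f' z, of \<gamma>], of a] this]
    show "((\<lambda>z. a * hornich \<gamma> f z + exp (a * Ln (1 - z))) has_field_derivative 0) (at z within unit_disk)"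
      by (simp add: has_field_derivative_at_within)
  qed
  then obtain k where k: "\<And>z. z \<in> unit_disk \<Longrightarrow> a * hornich \<gamma> f z + exp (a * Ln (1 - z)) = k" by blast
  have "\<not> inj_on (hornich \<gamma> f) unit_disk"
  proof
    assume inj: "inj_on (hornich \<gamma> f) unit_disk"
    have "inj_on (\<lambda>z. exp (a * Ln (1 - z))) unit_disk"
    proof (rule inj_onI)
      fix x y assume xy: "x \<in> unit_disk" "y \<in> unit_disk" "exp (a * Ln (1 - x)) = exp (a * Ln (1 - y))"
      then have "a * hornich \<gamma> f x = a * hornich \<gamma> f y" using k[of x] k[of y] by (metis add_right_cancel)
      then show "x = y" using \<open>a \<noteq> 0\<close> inj_onD[OF inj _ xy(1,2)] by simp
    qed
    moreover have "norm (a - 1) > 1" "norm (a + 1) > 1"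
      using \<mu>(3,4) norm_minus_commute[of "of_real \<mu> * c" 2] by (simp_all add: a_def)
    ultimately show False using power_not_injective by blast
  qed
  then show ?thesis using that f classS_hornich_iff[OF f'] by blast
qed

theorem theorem2p1:
  fixes lam :: real
  assumes "lam < 1"
  shows "{\<gamma>::complex. \<forall>f. classK lam f \<longrightarrow> classS (hornich \<gamma> f)} =
         {\<gamma>. cmod \<gamma> \<le> 1 / (2 * (1 - lam))} \<union>
         complex_of_real ` {1 / (2 * (1 - lam)) .. 3 / (2 * (1 - lam))}"
proof (intro equalityI subsetI)
  fix \<gamma> assume \<gamma>: "\<gamma> \<in> {\<gamma>::complex. \<forall>f. classK lam f \<longrightarrow> classS (hornich \<gamma> f)}"
  show "\<gamma> \<in> {\<gamma>. cmod \<gamma> \<le> 1 / (2 * (1 - lam))} \<union>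
         complex_of_real ` {1 / (2 * (1 - lam)) .. 3 / (2 * (1 - lam))}"
  proof (rule ccontr)
    assume "\<not> ?thesis"
    then obtain f where "classK lam f" "\<not> classS (hornich \<gamma> f)"
      using hornich_not_univalent[OF assms, of \<gamma>] by (auto simp: not_le)
    then show False using \<gamma> by blast
  qed
next
  fix \<gamma> assume "\<gamma> \<in> {\<gamma>. cmod \<gamma> \<le> 1 / (2 * (1 - lam))} \<union>
         complex_of_real ` {1 / (2 * (1 - lam)) .. 3 / (2 * (1 - lam))}"
  then have "classS (hornich \<gamma> f)" if "classK lam f" for f
    using hornich_univalent[OF assms that, of \<gamma>] by blast
  then show "\<gamma> \<in> {\<gamma>::complex. \<forall>f. classK lam f \<longrightarrow> classS (hornich \<gamma> f)}" by blast
qed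

end
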